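(* Let $d\ge1$, $\Omega=[0,1]^d$, $s\ge0$, and let $f\in\mathcal B^s(\Omega)$ satisfy $\int_\Omega f(x)\,dx=0$. Then the unique mean-zero weak solution $u^*\in H^1(\Omega)$ of the Neumann problem $-\Delta u=f$ on $\Omega$, $\partial u/\partial\nu=0$ on $\partial\Omega$, satisfies $u^*\in\mathcal B^{s+2}(\Omega)$ and $$\|u^*\|_{\mathcal B^{s+2}(\Omega)}\le d\,\|f\|_{\mathcal B^s(\Omega)}.$$ In particular, when $s=0$, $\|u^*\|_{\mathcal B^2(\Omega)}\le d\,\|f\|_{\mathcal B^0(\Omega)}$.
   Context: $\mathbb N_0=\{0,1,2,\dots\}$ and $|\cdot|_1$ is the $\ell^1$-norm. For $k\in\mathbb N_0^d$ put $\Phi_k(x)=\prod_{i=1}^d\cos(\pi k_ix_i)$, and for $u\in L^1(\Omega)$ let $\hat u(k)=\int_\Omega u\,\Phi_k\,dx\big/\int_\Omega\Phi_k^2\,dx$. For $s\ge0$ the spectral Barron space is $\mathcal B^s(\Omega)=\{u\in L^1(\Omega):\|u\|_{\mathcal B^s(\Omega)}<\infty\}$ with $\|u\|_{\mathcal B^s(\Omega)}=\sum_{k\in\mathbb N_0^d}(1+\pi^s|k|_1^s)|\hat u(k)|$ (for $s=0$, $|k|_1^0$ is read as $1$). The weak solution is the unique $u^*\in H^1(\Omega)$ with $\int_\Omega u^*dx=0$ and $\int_\Omega\nabla u^*\cdot\nabla v\,dx=\int_\Omega fv\,dx$ for all $v\in H^1(\Omega)$ with $\int_\Omega v\,dx=0$.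 *)

theory Defs
  imports "HOL-Analysis.Analysis"
begin

text \<open>
  Elements of \<open>L\<^sup>1(\<Omega>)\<close>, \<open>H\<^sup>1(\<Omega>)\<close> etc. are represented by functions on the whole of
  \<^typ>\<open>real ^ 'd\<close> of which only the values on the cube matter; the dimension is
  \<open>d = CARD('d)\<close>, which is at least 1 because types are nonempty.
\<close>

definition unit_cube :: "(real ^ 'd) set" where
  "unit_cube = cbox 0 1"

abbreviation cube_measure :: "(real ^ 'd) measure" where
  "cube_measure \<equiv> lebesgue_on unit_cube"


subsection \<open>Spectral Barron spaces\<close>

definition cos_basis :: "nat ^ 'd \<Rightarrow> real ^ 'd \<Rightarrow> real" where
  "cos_basis k x = (\<Prod>i\<in>UNIV. cos (pi * real (k $ i) * x $ i))"

definition cos_coeff :: "(real ^ 'd \<Rightarrow> real) \<Rightarrow> nat ^ 'd \<Rightarrow> real" where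
  "cos_coeff u k =
     (LINT x|cube_measure. u x * cos_basis k x) / (LINT x|cube_measure. (cos_basis k x)\<^sup>2)"

definition l1_norm :: "nat ^ 'd \<Rightarrow> real" where
  "l1_norm k = (\<Sum>i\<in>UNIV. real (k $ i))"

text \<open>
  The case distinction is needed because \<^term>\<open>0 powr (0::real)\<close> is \<open>0\<close>, whereas
  for \<open>s = 0\<close> the power of the \<open>\<ell>\<^sup>1\<close>-norm is to be read as \<open>1\<close> also at \<open>k = 0\<close>.
\<close>

definition barron_weight :: "real \<Rightarrow> nat ^ 'd \<Rightarrow> real" where
  "barron_weight s k = 1 + pi powr s * (if s = 0 then 1 else l1_norm k powr s)"

definition barron_norm :: "real \<Rightarrow> (real ^ 'd \<Rightarrow> real) \<Rightarrow> ennreal" where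
  "barron_norm s u = (\<Sum>\<^sub>\<infinity>k\<in>UNIV. ennreal (barron_weight s k * \<bar>cos_coeff u k\<bar>))"

definition barron_space :: "real \<Rightarrow> (real ^ 'd \<Rightarrow> real) set" where
  "barron_space s = {u. integrable cube_measure u \<and> barron_norm s u < \<infinity>}"


subsection \<open>The Sobolev space \<open>H\<^sup>1\<close> of the cube\<close>

definition partial_deriv :: "'d \<Rightarrow> (real ^ 'd \<Rightarrow> real) \<Rightarrow> real ^ 'd \<Rightarrow> real" where
  "partial_deriv i \<phi> x = frechet_derivative \<phi> (at x) (axis i 1)"

primrec times_cont_diff :: "nat \<Rightarrow> (real ^ 'd \<Rightarrow> real) \<Rightarrow> bool" where
  "times_cont_diff 0 \<phi> \<longleftrightarrow> continuous_on UNIV \<phi>"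
| "times_cont_diff (Suc n) \<phi> \<longleftrightarrow>
     (\<forall>x. \<phi> differentiable (at x)) \<and> (\<forall>i. times_cont_diff n (partial_deriv i \<phi>))"

text \<open>Test functions \<open>C\<^sub>c\<^sup>\<infinity>\<close> on the open cube, extended by zero.\<close>

definition test_functions :: "(real ^ 'd \<Rightarrow> real) set" where
  "test_functions =
     {\<phi>. (\<forall>n. times_cont_diff n \<phi>) \<and> compact (closure {x. \<phi> x \<noteq> 0})
        \<and> closure {x. \<phi> x \<noteq> 0} \<subseteq> interior unit_cube}"

definition L2_cube :: "(real ^ 'd \<Rightarrow> real) set" where
  "L2_cube = {u. u \<in> borel_measurable cube_measure \<and> integrable cube_measure (\<lambda>x. (u x)\<^sup>2)}"

definition has_weak_gradient :: "(real ^ 'd \<Rightarrow> real) \<Rightarrow> (real ^ 'd \<Rightarrow> real ^ 'd) \<Rightarrow> bool" where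
  "has_weak_gradient u G \<longleftrightarrow>
     (\<forall>i. (\<lambda>x. G x $ i) \<in> L2_cube \<and>
        (\<forall>\<phi>\<in>test_functions.
           (LINT x|cube_measure. u x * partial_deriv i \<phi> x) =
           - (LINT x|cube_measure. G x $ i * \<phi> x)))"

definition H1_cube :: "(real ^ 'd \<Rightarrow> real) set" where
  "H1_cube = {u \<in> L2_cube. \<exists>G. has_weak_gradient u G}"

text \<open>Weak gradients are determined only almost everywhere, so one is chosen.\<close>

definition weak_gradient :: "(real ^ 'd \<Rightarrow> real) \<Rightarrow> real ^ 'd \<Rightarrow> real ^ 'd" where
  "weak_gradient u = (SOME G. has_weak_gradient u G)"


subsection \<open>The Neumann problem\<close>

definition mean_zero :: "(real ^ 'd \<Rightarrow> real) \<Rightarrow> bool" where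
  "mean_zero u \<longleftrightarrow> (LINT x|cube_measure. u x) = 0"

definition neumann_weak_solution :: "(real ^ 'd \<Rightarrow> real) \<Rightarrow> (real ^ 'd \<Rightarrow> real) \<Rightarrow> bool" where
  "neumann_weak_solution f u \<longleftrightarrow>
     u \<in> H1_cube \<and> mean_zero u \<and>
     (\<forall>v\<in>H1_cube. mean_zero v \<longrightarrow>
        (LINT x|cube_measure. weak_gradient u x \<bullet> weak_gradient v x) =
        (LINT x|cube_measure. f x * v x))"

end

theory Submission
  imports Defs
begin

text \<open>
  The cosine products \<open>\<Phi>\<^sub>k\<close> (\<^const>\<open>cos_basis\<close>) are eigenfunctions of \<open>-\<Delta>\<close> with Neumann boundary
  conditions, with eigenvalue \<open>\<lambda>\<^sub>k = \<Sum>\<^sub>i (\<pi> k\<^sub>i)\<^sup>2\<close>. Testing the weak formulation with \<open>\<Phi>\<^sub>k\<close> therefore shows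
  that the \<open>k\<close>-th cosine coefficient of any weak solution is that of \<open>f\<close> divided by \<open>\<lambda>\<^sub>k\<close>, for
  \<open>k \<noteq> 0\<close>, while the coefficient at \<open>k = 0\<close> vanishes because the solution has mean zero
  (\<open>weak_solution_cos_coeff\<close>). The norm estimate is then a comparison of weights:
  \<open>\<pi>\<^sup>2 \<bar>k\<bar>\<^sub>1\<^sup>2 \<le> d \<lambda>\<^sub>k\<close> by Cauchy--Schwarz (\<open>barron_weight_shift_le\<close>). Uniqueness holds because an integrable function
  is determined by its cosine coefficients (\<open>cos_basis_complete\<close>). For existence one sums the cosine
  series with these coefficients; it and its termwise gradient converge uniformly, since the
  coefficients of \<open>f\<close> are absolutely summable (\<open>weak_solution_exists\<close>).

  Two points need care. First, a weak gradient is tested only against smooth functions supported in the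
  open cube, whereas the derivatives of \<open>\<Phi>\<^sub>k\<close> in general do not vanish near the boundary. Since
  \<open>\<partial>\<^sub>i \<Phi>\<^sub>k\<close> does vanish on the two faces orthogonal to the \<open>i\<close>-th axis, it can be approximated by test
  functions whose \<open>i\<close>-th derivatives stay bounded (\<open>weak_derivative_against_sin_basis\<close>). Second, \<open>f\<close> is
  only assumed to be integrable; that it agrees almost everywhere with its cosine series
  (\<open>cos_series_AE\<close>), and so is bounded, is again a consequence of completeness. Completeness itself
  follows from the Stone--Weierstrass theorem.
\<close>

section \<open>Smooth functions and cutoffs in one variable\<close>

text \<open>
  \<open>smooth_upto n\<close> is \<open>C\<^sup>n\<close> in one variable. The recursion has the same shape as that of
  \<^const>\<open>times_cont_diff\<close>, so that a product of such functions in separate coordinates can be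
  shown to be \<^const>\<open>times_cont_diff\<close> by one induction.
\<close>

primrec smooth_upto :: "nat \<Rightarrow> (real \<Rightarrow> real) \<Rightarrow> bool" where
  "smooth_upto 0 g \<longleftrightarrow> continuous_on UNIV g"
| "smooth_upto (Suc n) g \<longleftrightarrow>
     (\<exists>g'. (\<forall>t. (g has_real_derivative g' t) (at t)) \<and> smooth_upto n g')"

lemma smooth_upto_SucI:
  "(\<And>t. (g has_real_derivative g' t) (at t)) \<Longrightarrow> smooth_upto n g' \<Longrightarrow> smooth_upto (Suc n) g"
  by auto

lemma smooth_upto_Suc_imp: "smooth_upto (Suc n) g \<Longrightarrow> smooth_upto n g"
proof (induction n arbitrary: g)
  case 0
  then show ?case
    by (auto simp: continuous_on_eq_continuous_at intro: DERIV_isCont)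
next
  case (Suc n)
  then show ?case by (metis smooth_upto.simps(2))
qed

lemma smooth_upto_add:
  "smooth_upto n f \<Longrightarrow> smooth_upto n g \<Longrightarrow> smooth_upto n (\<lambda>t. f t + g t)"
proof (induction n arbitrary: f g)
  case 0
  then show ?case by (auto intro!: continuous_intros)
next
  case (Suc n)
  then obtain f' g' where
    "\<And>t. (f has_real_derivative f' t) (at t)" "smooth_upto n f'"
    "\<And>t. (g has_real_derivative g' t) (at t)" "smooth_upto n g'" by auto
  then have "((\<lambda>t. f t + g t) has_real_derivative f' t + g' t) (at t)"
    "smooth_upto n (\<lambda>t. f' t + g' t)" for t
    by (auto intro: DERIV_add Suc.IH)
  then show ?case by (rule smooth_upto_SucI)
qed

lemma smooth_upto_mult:
  "smooth_upto n f \<Longrightarrow> smooth_upto n g \<Longrightarrow> smooth_upto n (\<lambda>t. f t * g t)"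
proof (induction n arbitrary: f g)
  case 0
  then show ?case by (auto intro!: continuous_intros)
next
  case (Suc n)
  then obtain f' g' where d:
    "\<And>t. (f has_real_derivative f' t) (at t)" "smooth_upto n f'"
    "\<And>t. (g has_real_derivative g' t) (at t)" "smooth_upto n g'" by auto
  have "smooth_upto n (\<lambda>t. f' t * g t + g' t * f t)"
    using d Suc.prems by (intro smooth_upto_add Suc.IH) (simp_all only: smooth_upto_Suc_imp)
  moreover have "((\<lambda>t. f t * g t) has_real_derivative f' t * g t + g' t * f t) (at t)" for t
    using d by (intro DERIV_mult)
  ultimately show ?case by (intro smooth_upto_SucI)
qed

lemma smooth_upto_compose:
  "smooth_upto n f \<Longrightarrow> smooth_upto n g \<Longrightarrow> smooth_upto n (\<lambda>t. f (g t))"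
proof (induction n arbitrary: f)
  case 0
  then have "continuous_on UNIV f" "continuous_on UNIV g" by auto
  then show ?case using continuous_on_compose2[of UNIV f UNIV g] by simp
next
  case (Suc n)
  then obtain f' g' where d:
    "\<And>t. (f has_real_derivative f' t) (at t)" "smooth_upto n f'"
    "\<And>t. (g has_real_derivative g' t) (at t)" "smooth_upto n g'" by auto
  have "smooth_upto n (\<lambda>t. f' (g t) * g' t)"
    by (rule smooth_upto_mult[OF Suc.IH[OF d(2) smooth_upto_Suc_imp[OF Suc.prems(2)]] d(4)])
  moreover have "((\<lambda>t. f (g t)) has_real_derivative f' (g t) * g' t) (at t)" for t
    by (rule DERIV_chain2[OF d(1,3)])
  ultimately show ?case by (intro smooth_upto_SucI)
qed

lemma smooth_upto_const: "smooth_upto n (\<lambda>t. c)"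
proof (induction n arbitrary: c)
  case (Suc n)
  show ?case by (rule smooth_upto_SucI[OF DERIV_const Suc])
qed simp

lemma smooth_upto_ident: "smooth_upto n (\<lambda>t. t)"
proof (cases n)
  case (Suc m)
  show ?thesis unfolding Suc by (rule smooth_upto_SucI[OF DERIV_ident smooth_upto_const])
qed simp

text \<open>
  The factor \<open>c\<close> in the proof makes the induction close: differentiation
  maps the family of multiples of these two functions into itself.
\<close>

lemma smooth_upto_cos_sin:
  "smooth_upto n (\<lambda>t. cos (a * t + b))"
  "smooth_upto n (\<lambda>t. sin (a * t + b))"
proof -
  have "smooth_upto n (\<lambda>t. c * cos (a * t + b)) \<and> smooth_upto n (\<lambda>t. c * sin (a * t + b))" for c
  proof (induction n arbitrary: c)
    case 0
    then show ?case by (auto intro!: continuous_intros)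
  next
    case (Suc n)
    have "((\<lambda>t. c * cos (a * t + b)) has_real_derivative (- c * a) * sin (a * t + b)) (at t)"
      "((\<lambda>t. c * sin (a * t + b)) has_real_derivative (c * a) * cos (a * t + b)) (at t)" for t
      by (auto intro!: derivative_eq_intros)
    then show ?case
      using Suc[of "- c * a"] Suc[of "c * a"] by (intro conjI; rule_tac smooth_upto_SucI) blast+
  qed
  from this[of 1] show "smooth_upto n (\<lambda>t. cos (a * t + b))" "smooth_upto n (\<lambda>t. sin (a * t + b))"
    by auto
qed

text \<open>
  The functions \<open>P (1 / t) exp (- 1 / t)\<close>, with \<open>P\<close> a polynomial, extended by zero to \<open>t \<le> 0\<close>,
  are closed under differentiation: with \<open>y = 1 / t\<close> the derivative has the polynomial
  \<open>y\<^sup>2 (P - P')\<close>. At \<open>0\<close> the exponential beats every power of \<open>1 / t\<close>. Hence each of them is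
  smooth on the whole line.
\<close>

lemma has_real_derivative_flat_zero_extension:
  fixes P :: "real poly"
  defines "F \<equiv> \<lambda>P t. if 0 < t then poly P (1 / t) * exp (- (1 / t)) else 0 :: real"
  shows "(F P has_real_derivative F ([:0, 0, 1:] * (P - pderiv P)) t) (at t)"
proof -
  consider "t > 0" | "t < 0" | "t = 0" by linarith
  then show ?thesis
  proof cases
    case 1
    have "((\<lambda>t. poly P (1 / t) * exp (- (1 / t))) has_real_derivative
        F ([:0, 0, 1:] * (P - pderiv P)) t) (at t)"
      using 1 unfolding F_def
      by (auto intro!: derivative_eq_intros DERIV_chain2[OF poly_DERIV, of "\<lambda>t. 1 / t"] simp: field_simps power2_eq_square)
    then show ?thesis
      by (rule has_field_derivative_transform_within_open[where S = "{0<..}"])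
         (use 1 in \<open>auto simp: F_def\<close>)
  next
    case 2
    have "((\<lambda>t. 0) has_real_derivative F ([:0, 0, 1:] * (P - pderiv P)) t) (at t)"
      using 2 unfolding F_def by (auto intro!: derivative_eq_intros)
    then show ?thesis
      by (rule has_field_derivative_transform_within_open[where S = "{..<0}"])
         (use 2 in \<open>auto simp: F_def\<close>)
  next
    case 3
    have pol: "((\<lambda>x. poly Q x / exp x) \<longlongrightarrow> 0) at_top" for Q :: "real poly"
    proof -
      have "((\<lambda>x. \<Sum>i\<le>degree Q. coeff Q i * (x ^ i / exp x)) \<longlongrightarrow> (\<Sum>i\<le>degree Q. coeff Q i * 0)) at_top"
        by (intro tendsto_intros tendsto_power_div_exp_0)
      then show ?thesis
        by (simp add: poly_altdef sum_divide_distrib)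
    qed
    have "((\<lambda>x. poly ([:0, 1:] * P) (inverse x) / exp (inverse x)) \<longlongrightarrow> 0) (at_right 0)"
      by (rule filterlim_compose[OF pol filterlim_inverse_at_top_right])
    then have "((\<lambda>h. F P h / h) \<longlongrightarrow> 0) (at_right 0)"
      by (rule Lim_transform_eventually)
         (auto simp: eventually_at_filter F_def exp_minus field_simps)
    moreover have "((\<lambda>h. F P h / h) \<longlongrightarrow> 0) (at_left 0)"
      by (rule tendsto_eventually) (auto simp: eventually_at_filter F_def)
    ultimately have "((\<lambda>h. F P h / h) \<longlongrightarrow> 0) (at 0)"
      by (rule filterlim_split_at[rotated])
    then show ?thesis
      using 3 by (simp add: DERIV_def F_def cong: if_cong)
  qed
qed

definition flat_exp :: "real \<Rightarrow> real" where
  "flat_exp t = (if 0 < t then exp (- (1 / t)) else 0)"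

definition flat_exp' :: "real \<Rightarrow> real" where
  "flat_exp' t = (if 0 < t then exp (- (1 / t)) / t\<^sup>2 else 0)"

lemma flat_exp_deriv: "(flat_exp has_real_derivative flat_exp' t) (at t)"
  using has_real_derivative_flat_zero_extension[of 1 t]
  by (simp add: flat_exp_def[abs_def] flat_exp'_def power2_eq_square if_distrib cong: if_cong)

lemma smooth_upto_flat_exp: "smooth_upto n flat_exp"
proof -
  have "smooth_upto n (\<lambda>t. if 0 < t then poly P (1 / t) * exp (- (1 / t)) else 0 :: real)" for P :: "real poly"
  proof (induction n arbitrary: P)
    case 0
    then show ?case
      using has_real_derivative_flat_zero_extension[of P]
      by (auto simp: continuous_on_eq_continuous_at intro: DERIV_isCont)
  next
    case (Suc n)
    show ?case
      by (rule smooth_upto_SucI[OF has_real_derivative_flat_zero_extension Suc])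
  qed
  from this[of 1] show ?thesis by (simp add: flat_exp_def[abs_def] cong: if_cong)
qed

text \<open>
  The third bound is what keeps the derivative of a sine times a cutoff bounded: the
  argument \<open>t\<close> of \<^const>\<open>flat_exp\<close> will be \<open>n x (1 - x) - 1\<close>, and the sine contributes
  a factor of order \<open>x (1 - x)\<close>, that is \<open>(t + 1) / n\<close>. With \<open>y = 1 / t\<close> it reads
  \<open>(y + y\<^sup>2) exp (- y) \<le> 3\<close>.
\<close>

lemma flat_exp_bounds:
  "0 \<le> flat_exp t" "flat_exp t \<le> 1" "(t + 1) * flat_exp' t \<le> 3" "0 \<le> flat_exp' t"
proof -
  show "0 \<le> flat_exp t" "flat_exp t \<le> 1" "0 \<le> flat_exp' t"
    by (auto simp: flat_exp_def flat_exp'_def)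
  show "(t + 1) * flat_exp' t \<le> 3"
  proof (cases "t > 0")
    case True
    define y where "y = 1 / t"
    have y: "y > 0" using True by (simp add: y_def)
    have "y + y\<^sup>2 \<le> 3 * exp y"
      using exp_lower_Taylor_quadratic[of y] zero_le_square[of y] y unfolding power2_eq_square by linarith
    then have "(y + y\<^sup>2) * exp (- y) \<le> 3"
      by (simp add: exp_minus field_simps)
    moreover have "(t + 1) * flat_exp' t = (y + y\<^sup>2) * exp (- y)"
      using True by (simp add: flat_exp'_def y_def field_simps power2_eq_square)
    ultimately show ?thesis by simp
  qed (simp add: flat_exp'_def)
qed

text \<open>
  A smooth cutoff for the unit interval, vanishing outside \<open>[1/n, 1 - 1/n]\<close> (and zero for \<open>n = 0\<close>). It has no plateau
  where it equals \<open>1\<close>; pointwise convergence to \<open>1\<close> on the open interval as \<open>n\<close> grows, with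
  uniform bounds, is enough for dominated convergence.
\<close>

definition cutoff :: "nat \<Rightarrow> real \<Rightarrow> real" where
  "cutoff n t = flat_exp (real n * (t * (1 - t)) - 1)"

definition cutoff' :: "nat \<Rightarrow> real \<Rightarrow> real" where
  "cutoff' n t = flat_exp' (real n * (t * (1 - t)) - 1) * (real n * (1 - 2 * t))"

lemma cutoff_deriv: "(cutoff n has_real_derivative cutoff' n t) (at t)"
  unfolding cutoff_def[abs_def] cutoff'_def
  by (rule DERIV_chain2[OF flat_exp_deriv]) (auto intro!: derivative_eq_intros simp: algebra_simps)

lemma smooth_upto_cutoff: "smooth_upto m (cutoff n)"
proof -
  have "smooth_upto m (\<lambda>t. flat_exp (real n * (t * (1 + (-1) * t)) + (-1)))"
    by (rule smooth_upto_compose[OF smooth_upto_flat_exp])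
       (rule smooth_upto_add smooth_upto_mult smooth_upto_const smooth_upto_ident)+
  then show ?thesis by (simp add: cutoff_def[abs_def])
qed

lemma cutoff_bounds: "0 \<le> cutoff n t" "cutoff n t \<le> 1"
  by (simp_all add: cutoff_def flat_exp_bounds)

lemma cutoff_nonzeroD:
  assumes "cutoff n t \<noteq> 0" shows "1 / real n \<le> t" "t \<le> 1 - 1 / real n" "n > 0"
proof -
  have *: "real n * (t * (1 - t)) > 1"
    using assms by (auto simp: cutoff_def flat_exp_def split: if_splits)
  then show n: "n > 0" by (cases n) auto
  then have "t * (1 - t) > 0"
    using * by (smt (verit) mult_nonneg_nonpos of_nat_0_le_iff)
  then have t: "0 < t" "t < 1"
    by (auto simp: zero_less_mult_iff)
  have "real n * (t * (1 - t)) \<le> real n * t" "real n * (t * (1 - t)) \<le> real n * (1 - t)"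
    using t n by (auto intro!: mult_left_mono simp: mult_le_cancel_left1 mult_le_cancel_right1)
  then have "1 \<le> real n * t" "1 \<le> real n * (1 - t)" using * by auto
  then show "1 / real n \<le> t" "t \<le> 1 - 1 / real n" using n by (auto simp: field_simps)
qed

lemma filterlim_cutoff_argument:
  assumes "0 < t" "t < 1"
  shows "filterlim (\<lambda>n. real n * (t * (1 - t)) - 1) at_top sequentially"
proof -
  have "filterlim (\<lambda>n. real n * (t * (1 - t))) at_top sequentially"
    using assms by (intro filterlim_at_top_mult_tendsto_pos[OF tendsto_const _ filterlim_real_sequentially]) auto
  from filterlim_tendsto_add_at_top[OF tendsto_const[of "-1"] this] show ?thesis by simp
qed

lemma cutoff_tendsto:
  assumes "0 < t" "t < 1"
  shows "(\<lambda>n. cutoff n t) \<longlonglongrightarrow> 1"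
proof -
  have "((\<lambda>s::real. exp (- inverse s)) \<longlongrightarrow> exp (- 0)) at_top"
    by (intro tendsto_intros tendsto_inverse_0_at_top filterlim_ident)
  moreover have "\<forall>\<^sub>F s in at_top. exp (- inverse s) = flat_exp s"
    using eventually_gt_at_top[of 0] by eventually_elim (simp add: flat_exp_def inverse_eq_divide)
  ultimately have "(flat_exp \<longlongrightarrow> 1) at_top"
    by (auto intro: Lim_transform_eventually)
  from filterlim_compose[OF this filterlim_cutoff_argument[OF assms]] show ?thesis
    by (simp add: cutoff_def)
qed

text \<open>
  With \<open>s = n t (1 - t) - 1\<close>, the derivative is a constant multiple, for fixed \<open>t\<close>, of
  \<open>(s + 1)\<close> times the derivative of \<^const>\<open>flat_exp\<close> at \<open>s\<close>, which is of order \<open>1 / s\<close>.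
\<close>

lemma cutoff'_tendsto:
  assumes "0 < t" "t < 1"
  shows "(\<lambda>n. cutoff' n t) \<longlonglongrightarrow> 0"
proof -
  define p where "p = t * (1 - t)"
  have p: "p > 0" using assms by (simp add: p_def)
  have "((\<lambda>s::real. inverse s * (1 + inverse s) * exp (- inverse s)) \<longlongrightarrow> 0 * (1 + 0) * exp (- 0)) at_top"
    by (intro tendsto_intros tendsto_inverse_0_at_top filterlim_ident)
  moreover have "\<forall>\<^sub>F s in at_top. inverse s * (1 + inverse s) * exp (- inverse s) = (s + 1) * flat_exp' s"
    using eventually_gt_at_top[of 0]
    by eventually_elim (simp add: flat_exp'_def field_simps power2_eq_square)
  ultimately have "((\<lambda>s. (s + 1) * flat_exp' s) \<longlongrightarrow> 0) at_top"
    by (auto intro: Lim_transform_eventually)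
  from filterlim_compose[OF this filterlim_cutoff_argument[OF assms]]
  have "(\<lambda>n. (real n * p) * flat_exp' (real n * p - 1)) \<longlonglongrightarrow> 0"
    by (simp add: p_def)
  from tendsto_mult[OF this tendsto_const[of "(1 - 2 * t) / p"]] show ?thesis
    using p by (simp add: cutoff'_def flip: p_def) (simp add: mult_ac)
qed

text \<open>
  The sine vanishes at both ends of the interval because \<open>k\<close> is an integer; whichever end
  is nearer gives the bound.
\<close>

lemma abs_sin_nat_pi_le:
  assumes "0 \<le> t" "t \<le> 1"
  shows "\<bar>sin (pi * real k * t)\<bar> \<le> 2 * pi * real k * (t * (1 - t))"
proof -
  have 1: "\<bar>sin (pi * real k * t)\<bar> \<le> pi * real k * t"
    using abs_sin_x_le_abs_x[of "pi * real k * t"] assms by (simp add: abs_mult)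
  have "sin (pi * real k * (1 - t)) = sin (pi * real k) * cos (pi * real k * t) - cos (pi * real k) * sin (pi * real k * t)"
    by (simp add: right_diff_distrib sin_diff)
  then have "\<bar>sin (pi * real k * (1 - t))\<bar> = \<bar>sin (pi * real k * t)\<bar>"
    by (simp add: abs_mult mult.commute[of pi])
  then have 2: "\<bar>sin (pi * real k * t)\<bar> \<le> pi * real k * (1 - t)"
    using abs_sin_x_le_abs_x[of "pi * real k * (1 - t)"] assms by (simp add: abs_mult)
  show ?thesis
  proof (cases "t \<le> 1/2")
    case True
    then have "t \<le> 2 * (t * (1 - t))"
      using assms mult_left_mono[of 1 "2 * (1 - t)" t] by (simp add: mult_ac)
    then have "pi * real k * t \<le> pi * real k * (2 * (t * (1 - t)))"
      by (intro mult_left_mono) auto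
    from order_trans[OF 1 this] show ?thesis by (simp only: mult_ac)
  next
    case False
    then have "1 - t \<le> 2 * (t * (1 - t))"
      using assms mult_left_mono[of 1 "2 * t" "1 - t"] by (simp add: mult_ac)
    then have "pi * real k * (1 - t) \<le> pi * real k * (2 * (t * (1 - t)))"
      by (intro mult_left_mono) auto
    from order_trans[OF 2 this] show ?thesis by (simp only: mult_ac)
  qed
qed

text \<open>
  The derivative of the cutoff is of size \<open>n\<close> in the boundary layers, where the sine is
  only of size \<open>1 / n\<close>.
\<close>

lemma abs_sin_cutoff'_le:
  assumes "0 \<le> t" "t \<le> 1"
  shows "\<bar>sin (pi * real k * t) * cutoff' n t\<bar> \<le> 6 * pi * real k"
proof -
  define s where "s = real n * (t * (1 - t)) - 1"
  have "\<bar>sin (pi * real k * t) * cutoff' n t\<bar> =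
      \<bar>sin (pi * real k * t)\<bar> * (flat_exp' s * real n) * \<bar>1 - 2 * t\<bar>"
    by (simp add: cutoff'_def abs_mult flat_exp_bounds flip: s_def)
  also have "\<dots> \<le> (2 * pi * real k * (t * (1 - t))) * (flat_exp' s * real n) * 1"
    using assms by (intro mult_mono abs_sin_nat_pi_le mult_nonneg_nonneg flat_exp_bounds) auto
  also have "\<dots> = 2 * pi * real k * ((s + 1) * flat_exp' s)"
    by (simp add: s_def mult_ac)
  also have "\<dots> \<le> 2 * pi * real k * 3"
    by (intro mult_left_mono flat_exp_bounds) auto
  finally show ?thesis by simp
qed

section \<open>Products of functions of separate coordinates\<close>

text \<open>
  Cosine products, their partial derivatives and the test functions built from them are all
  products of one function per coordinate, and a partial derivative changes just one factor.
\<close>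

definition tensor :: "('d::finite \<Rightarrow> real \<Rightarrow> real) \<Rightarrow> real ^ 'd \<Rightarrow> real" where
  "tensor g x = (\<Prod>j\<in>UNIV. g j (x $ j))"

lemma tensor_upd: "tensor (g(i := h)) x = h (x $ i) * (\<Prod>j\<in>UNIV - {i}. g j (x $ j))"
  unfolding tensor_def by (subst prod.remove[of _ i]) (auto intro!: prod.cong)

lemma tensor_upd_scale: "tensor (g(i := \<lambda>t. c * h t)) x = c * tensor (g(i := h)) x"
  by (simp add: tensor_upd)

lemma continuous_on_tensor:
  "(\<And>j. continuous_on UNIV (g j)) \<Longrightarrow> continuous_on S (tensor g)"
  unfolding tensor_def[abs_def]
  by (intro continuous_on_prod continuous_on_compose2[of UNIV "g _" S] continuous_intros) auto

lemma has_derivative_tensor: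
  assumes "\<And>j t. (g j has_real_derivative g' j t) (at t)"
  shows "(tensor g has_derivative (\<lambda>y. \<Sum>i\<in>UNIV. y $ i * tensor (g(i := g' i)) x)) (at x)"
proof -
  have "((\<lambda>x. g j (x $ j)) has_derivative (\<lambda>y. g' j (x $ j) * y $ j)) (at x)" for j
  proof -
    have "(g j has_derivative (*) (g' j (x $ j))) (at (x $ j))"
      using assms[of j "x $ j"] by (simp add: has_field_derivative_def)
    from has_derivative_compose[OF bounded_linear_imp_has_derivative[OF bounded_linear_vec_nth] this]
    show ?thesis .
  qed
  from has_derivative_prod[of UNIV "\<lambda>j x. g j (x $ j)" "\<lambda>j y. g' j (x $ j) * y $ j", OF this] show ?thesis
    by (simp add: tensor_def[abs_def, symmetric] tensor_upd mult_ac flip: tensor_def)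
qed

lemma partial_deriv_tensor:
  assumes "\<And>j t. (g j has_real_derivative g' j t) (at t)"
  shows "partial_deriv i (tensor g) = tensor (g(i := g' i))"
proof
  fix x
  have "partial_deriv i (tensor g) x = (\<Sum>j\<in>UNIV. axis i 1 $ j * tensor (g(j := g' j)) x)"
    unfolding partial_deriv_def by (subst frechet_derivative_at[OF has_derivative_tensor[OF assms], symmetric]) simp
  also have "\<dots> = (\<Sum>j\<in>UNIV. if i = j then tensor (g(j := g' j)) x else 0)"
    by (intro sum.cong) (auto simp: axis_def)
  finally show "partial_deriv i (tensor g) x = tensor (g(i := g' i)) x" by simp
qed

lemma times_cont_diff_tensor:
  assumes "\<And>j. smooth_upto n (g j)"
  shows "times_cont_diff n (tensor g)"
  using assms
proof (induction n arbitrary: g)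
  case 0
  then show ?case by (auto intro: continuous_on_tensor)
next
  case (Suc n)
  have "\<forall>j. \<exists>g'. (\<forall>t. (g j has_real_derivative g' t) (at t)) \<and> smooth_upto n g'"
    using Suc.prems by simp
  then obtain g' where g': "\<And>j t. (g j has_real_derivative g' j t) (at t)" "\<And>j. smooth_upto n (g' j)"
    by metis
  have "smooth_upto n (g j)" for j
    using Suc.prems by (rule smooth_upto_Suc_imp)
  then have "times_cont_diff n (partial_deriv i (tensor g))" for i
    unfolding partial_deriv_tensor[OF g'(1)] using g'(2) by (intro Suc.IH) simp
  then show ?case
    using has_derivative_tensor[of g g', OF g'(1)] by (auto intro: differentiableI)
qed

lemma tensor_tendsto:
  "(\<And>j. (\<lambda>n. G n j (x $ j)) \<longlonglongrightarrow> g j (x $ j)) \<Longrightarrow> (\<lambda>n. tensor (G n) x) \<longlonglongrightarrow> tensor g x"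
  unfolding tensor_def by (intro tendsto_prod)

lemma abs_tensor_le:
  "(\<And>j. \<bar>g j (x $ j)\<bar> \<le> B j) \<Longrightarrow> \<bar>tensor g x\<bar> \<le> prod B UNIV"
  unfolding tensor_def abs_prod by (intro prod_mono) auto

lemma mem_unit_cube: "x \<in> unit_cube \<longleftrightarrow> (\<forall>j. 0 \<le> x $ j \<and> x $ j \<le> 1)"
  by (simp add: unit_cube_def mem_box_cart)

lemma mem_interior_unit_cube: "x \<in> interior unit_cube \<longleftrightarrow> (\<forall>j. 0 < x $ j \<and> x $ j < 1)"
  by (simp add: unit_cube_def mem_box_cart)

text \<open>
  For \<open>n = 0\<close> the cutoff is zero everywhere; otherwise the support is contained in the cube
  \<open>[1/n, 1 - 1/n]\<close> in every coordinate.
\<close>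

lemma tensor_cutoff_test_function:
  assumes "\<And>j m. smooth_upto m (g j)"
  shows "tensor (\<lambda>j t. g j t * cutoff n t) \<in> test_functions"
proof (cases "n = 0")
  case True
  have "tensor (\<lambda>j t. g j t * cutoff n t) x = 0" for x
    using True by (simp add: tensor_def cutoff_def flat_exp_def)
  then show ?thesis
    using times_cont_diff_tensor[of _ "\<lambda>j t. g j t * cutoff n t"]
    by (simp add: test_functions_def assms smooth_upto_mult smooth_upto_cutoff)
next
  case False
  define C :: "(real ^ 'a) set" where "C = cbox (\<chi> j. 1 / real n) (\<chi> j. 1 - 1 / real n)"
  have sub: "{x. tensor (\<lambda>j t. g j t * cutoff n t) x \<noteq> 0} \<subseteq> C"
    using cutoff_nonzeroD[of n] by (auto simp: C_def mem_box_cart tensor_def)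
  then have cl: "closure {x. tensor (\<lambda>j t. g j t * cutoff n t) x \<noteq> 0} \<subseteq> C"
    by (rule closure_minimal) (simp add: C_def closed_cbox)
  have "1 / real n > 0" using False by simp
  have "C \<subseteq> interior unit_cube"
  proof
    fix x assume "x \<in> C"
    then have "1 / real n \<le> x $ j" "x $ j \<le> 1 - 1 / real n" for j
      by (auto simp: C_def mem_box_cart)
    with \<open>1 / real n > 0\<close> have "0 < x $ j \<and> x $ j < 1" for j
      by (meson diff_less_eq le_less_trans less_add_same_cancel1 less_le_trans)
    then show "x \<in> interior unit_cube" by (simp add: mem_interior_unit_cube)
  qed
  moreover have "compact (closure {x. tensor (\<lambda>j t. g j t * cutoff n t) x \<noteq> 0})"
    unfolding compact_closure using sub by (rule bounded_subset[rotated]) (simp add: C_def)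
  moreover have "times_cont_diff m (tensor (\<lambda>j t. g j t * cutoff n t))" for m
    by (intro times_cont_diff_tensor smooth_upto_mult assms smooth_upto_cutoff)
  ultimately show ?thesis
    using cl by (auto simp: test_functions_def)
qed

section \<open>Integration over the cube\<close>

lemma unit_cube_lebesgue [simp]: "unit_cube \<in> sets lebesgue"
  by (simp add: unit_cube_def)

lemma space_cube_measure [simp]: "space cube_measure = unit_cube"
  by (simp add: space_restrict_space)

lemma finite_cube_measure: "finite_measure cube_measure"
  unfolding unit_cube_def by (rule finite_measure_lebesgue_on) simp

lemma continuous_imp_measurable_cube:
  "continuous_on UNIV f \<Longrightarrow> f \<in> borel_measurable cube_measure"
  by (rule continuous_imp_measurable_on_sets_lebesgue) (auto intro: continuous_on_subset)

lemma integrable_cube_continuous: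
  fixes f :: "real ^ 'd \<Rightarrow> real"
  assumes "continuous_on UNIV f" shows "integrable cube_measure f"
  using assms unfolding unit_cube_def by (intro continuous_imp_integrable) (rule continuous_on_subset, auto)

lemma AE_cube_if_negligible:
  assumes "negligible N" "\<And>x. x \<in> unit_cube \<Longrightarrow> x \<notin> N \<Longrightarrow> P x"
  shows "AE x in cube_measure. P x"
proof -
  have "AE x in lebesgue. x \<notin> N"
    using assms(1) by (intro AE_not_in) (simp add: negligible_iff_null_sets)
  then show ?thesis
    by (simp add: AE_restrict_space_iff) (auto elim!: eventually_mono intro: assms(2))
qed

lemma AE_cube_interior: "AE x in cube_measure. \<forall>j. 0 < x $ j \<and> x $ j < 1"
proof (rule AE_cube_if_negligible)
  show "negligible (unit_cube - interior unit_cube :: (real ^ 'a) set)"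
    unfolding unit_cube_def interior_cbox by (rule negligible_frontier_interval)
qed (simp add: mem_interior_unit_cube)

lemma integrable_mult_bounded:
  fixes w g :: "'a \<Rightarrow> real"
  assumes "integrable M w" "g \<in> borel_measurable M" "AE x in M. \<bar>g x\<bar> \<le> C"
  shows "integrable M (\<lambda>x. w x * g x)"
proof (rule Bochner_Integration.integrable_bound)
  show "integrable M (\<lambda>x. C * w x)" using assms by simp
  show "(\<lambda>x. w x * g x) \<in> borel_measurable M" using assms by measurable
  show "AE x in M. norm (w x * g x) \<le> norm (C * w x)"
    using assms(3) by eventually_elim (auto simp: abs_mult mult.commute intro!: mult_right_mono)
qed

lemma bounded_convergence_weighted:
  fixes w :: "'a \<Rightarrow> real"
  assumes "integrable M w" "\<And>n. g n \<in> borel_measurable M" "h \<in> borel_measurable M"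
    and "\<And>n. AE x in M. \<bar>g n x\<bar> \<le> C" "AE x in M. (\<lambda>n. g n x) \<longlonglongrightarrow> h x"
  shows "(\<lambda>n. LINT x|M. w x * g n x) \<longlonglongrightarrow> (LINT x|M. w x * h x)"
proof (rule integral_dominated_convergence[where w = "\<lambda>x. \<bar>w x\<bar> * C"])
  show "AE x in M. (\<lambda>n. w x * g n x) \<longlonglongrightarrow> w x * h x"
    using assms(5) by eventually_elim (intro tendsto_intros)
  show "AE x in M. norm (w x * g n x) \<le> \<bar>w x\<bar> * C" for n
    using assms(4)[of n] by eventually_elim (auto simp: abs_mult intro!: mult_left_mono)
qed (use assms in \<open>auto intro!: borel_measurable_times\<close>)

section \<open>Integration by parts for weak derivatives against trigonometric products\<close>

definition cosines :: "nat ^ 'd \<Rightarrow> 'd \<Rightarrow> real \<Rightarrow> real" where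
  "cosines k j t = cos (pi * real (k $ j) * t)"

text \<open>
  Up to a factor, the functions \<open>sine_at i k\<close> are the factors of the \<open>i\<close>-th partial derivative
  of the cosine product with multi-index \<open>k\<close>.
\<close>

definition sine_at :: "'d \<Rightarrow> nat ^ 'd \<Rightarrow> 'd \<Rightarrow> real \<Rightarrow> real" where
  "sine_at i k = (cosines k)(i := \<lambda>t. sin (pi * real (k $ i) * t))"

definition sin_basis :: "'d::finite \<Rightarrow> nat ^ 'd \<Rightarrow> real ^ 'd \<Rightarrow> real" where
  "sin_basis i k = tensor (sine_at i k)"

lemma cos_basis_eq_tensor: "cos_basis k = tensor (cosines k)"
  by (simp add: fun_eq_iff cos_basis_def tensor_def cosines_def)

lemma smooth_upto_cosines: "smooth_upto m (cosines k j)"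
  using smooth_upto_cos_sin(1)[of m "pi * real (k $ j)" 0] by (simp add: cosines_def[abs_def])

lemma smooth_upto_sine_at: "smooth_upto m (sine_at i k j)"
  using smooth_upto_cos_sin(2)[of m "pi * real (k $ i)" 0] smooth_upto_cosines[of m k j]
  by (simp add: sine_at_def)

lemma abs_cosines_le: "\<bar>cosines k j t\<bar> \<le> 1"
  by (simp add: cosines_def)

lemma abs_sine_at_le: "\<bar>sine_at i k j t\<bar> \<le> 1"
  by (simp add: sine_at_def cosines_def)

lemma abs_cos_basis_le: "\<bar>cos_basis k x\<bar> \<le> 1"
  using abs_tensor_le[of "cosines k" x "\<lambda>_. 1"] by (simp add: cos_basis_eq_tensor abs_cosines_le)

lemma abs_sin_basis_le: "\<bar>sin_basis i k x\<bar> \<le> 1"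
  using abs_tensor_le[of "sine_at i k" x "\<lambda>_. 1"] by (simp add: sin_basis_def abs_sine_at_le)

lemma continuous_on_cos_basis: "continuous_on S (cos_basis k)"
  unfolding cos_basis_eq_tensor
  using smooth_upto_cosines[of 0 k] by (intro continuous_on_tensor) simp

lemma continuous_on_sin_basis: "continuous_on S (sin_basis i k)"
  unfolding sin_basis_def
  using smooth_upto_sine_at[of 0 i k] by (intro continuous_on_tensor) simp

lemmas measurable_cos_basis = continuous_imp_measurable_cube[OF continuous_on_cos_basis]
lemmas measurable_sin_basis = continuous_imp_measurable_cube[OF continuous_on_sin_basis]

text \<open>
  Products of bounded smooth functions are limits of test functions as far as integration against
  an integrable \<open>w\<close> is concerned: the cutoffs tend to \<open>1\<close> in the open cube.
\<close>

lemma cutoff_approximation: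
  fixes w :: "real ^ 'd::finite \<Rightarrow> real"
  assumes "integrable cube_measure w" "\<And>j m. smooth_upto m (g j)" "\<And>j t. \<bar>g j t\<bar> \<le> 1"
  shows "(\<lambda>n. LINT x|cube_measure. w x * tensor (\<lambda>j t. g j t * cutoff n t) x)
    \<longlonglongrightarrow> (LINT x|cube_measure. w x * tensor g x)"
proof (rule bounded_convergence_weighted[OF assms(1), where C = 1])
  have "smooth_upto 0 (\<lambda>t. g j t * cutoff n t)" "smooth_upto 0 (g j)" for j n
    by (intro smooth_upto_mult assms smooth_upto_cutoff)+
  then show "tensor (\<lambda>j t. g j t * cutoff n t) \<in> borel_measurable cube_measure"
    "tensor g \<in> borel_measurable cube_measure" for n
    by (auto intro!: continuous_imp_measurable_cube continuous_on_tensor)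
  have b: "\<bar>g j t * cutoff n t\<bar> \<le> 1" for j t n
    using mult_mono[OF assms(3)[of j t] cutoff_bounds(2)[of n t]] by (simp add: abs_mult cutoff_bounds)
  have "\<bar>tensor (\<lambda>j t. g j t * cutoff n t) x\<bar> \<le> 1" for n x
    using abs_tensor_le[of "\<lambda>j t. g j t * cutoff n t" x "\<lambda>_. 1"] b by simp
  then show "AE x in cube_measure. \<bar>tensor (\<lambda>j t. g j t * cutoff n t) x\<bar> \<le> 1" for n
    by simp
  show "AE x in cube_measure. (\<lambda>n. tensor (\<lambda>j t. g j t * cutoff n t) x) \<longlonglongrightarrow> tensor g x"
    using AE_cube_interior
  proof eventually_elim
    case (elim x)
    then have "(\<lambda>n. g j (x $ j) * cutoff n (x $ j)) \<longlonglongrightarrow> g j (x $ j) * 1" for j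
      by (intro tendsto_mult tendsto_const cutoff_tendsto) auto
    then show ?case by (intro tensor_tendsto) simp
  qed
qed

lemma orthogonal_to_cos_basis_if_orthogonal_to_test_functions:
  assumes "integrable cube_measure w"
    and "\<And>\<phi>. \<phi> \<in> test_functions \<Longrightarrow> (LINT x|cube_measure. w x * \<phi> x) = 0"
  shows "(LINT x|cube_measure. w x * cos_basis k x) = 0"
proof -
  have "(\<lambda>n. LINT x|cube_measure. w x * tensor (\<lambda>j t. cosines k j t * cutoff n t) x)
    \<longlonglongrightarrow> (LINT x|cube_measure. w x * cos_basis k x)"
    unfolding cos_basis_eq_tensor
    by (intro cutoff_approximation assms smooth_upto_cosines abs_cosines_le)
  then show ?thesis
    by (simp add: assms tensor_cutoff_test_function smooth_upto_cosines LIMSEQ_const_iff)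
qed

text \<open>
  The defining identity of a weak derivative holds for test functions only, but it extends to
  \<open>sin_basis i k\<close>, which is not compactly supported in the open cube. In the approximating test functions
  the \<open>i\<close>-th factor, which gets differentiated, is a sine times a cutoff: since the sine vanishes
  on the two faces orthogonal to \<open>e\<^sub>i\<close>, the derivatives stay bounded and no boundary term survives.
  The other factors, which need not vanish on their faces, are never differentiated. This is how
  the Neumann condition satisfied by the cosine products enters.
\<close>

lemma weak_derivative_against_sin_basis:
  fixes v h :: "real ^ 'd::finite \<Rightarrow> real"
  assumes v: "integrable cube_measure v" and h: "integrable cube_measure h"
    and weak: "\<And>\<phi>. \<phi> \<in> test_functions \<Longrightarrow>
      (LINT x|cube_measure. v x * partial_deriv i \<phi> x) = - (LINT x|cube_measure. h x * \<phi> x)"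
  shows "(LINT x|cube_measure. h x * sin_basis i k x) =
    - (pi * real (k $ i)) * (LINT x|cube_measure. v x * cos_basis k x)"
proof -
  define \<phi> where "\<phi> n = tensor (\<lambda>j t. sine_at i k j t * cutoff n t)" for n
  define s' where "s' n t = pi * real (k $ i) * cos (pi * real (k $ i) * t) * cutoff n t
      + cutoff' n t * sin (pi * real (k $ i) * t)" for n t
  have \<phi>_test: "\<phi> n \<in> test_functions" for n
    unfolding \<phi>_def by (intro tensor_cutoff_test_function smooth_upto_sine_at)
  \<comment> \<open>The factors of the \<open>i\<close>-th partial derivative of \<open>\<phi> n\<close>.\<close>
  define G where "G n = (\<lambda>j t. sine_at i k j t * cutoff n t)(i := s' n)" for n
  have d: "partial_deriv i (\<phi> n) = tensor (G n)" for n
  proof -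
    have "\<exists>D. \<forall>t. ((\<lambda>t. sine_at i k j t * cutoff n t) has_real_derivative D t) (at t)" for j
    proof -
      have "smooth_upto (Suc 0) (\<lambda>t. sine_at i k j t * cutoff n t)"
        by (intro smooth_upto_mult smooth_upto_sine_at smooth_upto_cutoff)
      then show ?thesis by auto
    qed
    then obtain D where D: "\<And>j t. ((\<lambda>t. sine_at i k j t * cutoff n t) has_real_derivative D j t) (at t)"
      by metis
    have "((\<lambda>t. sine_at i k i t * cutoff n t) has_real_derivative s' n t) (at t)" for t
      unfolding sine_at_def s'_def by (auto intro!: derivative_eq_intros cutoff_deriv)
    with D[of i] have "D i = s' n" by (auto intro: DERIV_unique)
    then show ?thesis
      unfolding \<phi>_def using partial_deriv_tensor[OF D, of i] by (simp add: G_def)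
  qed
  have "(\<lambda>n. LINT x|cube_measure. h x * \<phi> n x) \<longlonglongrightarrow> (LINT x|cube_measure. h x * sin_basis i k x)"
    unfolding \<phi>_def sin_basis_def
    by (intro cutoff_approximation h smooth_upto_sine_at abs_sine_at_le)
  moreover have "(\<lambda>n. LINT x|cube_measure. v x * tensor (G n) x)
      \<longlonglongrightarrow> (LINT x|cube_measure. v x * (pi * real (k $ i) * cos_basis k x))"
  proof (rule bounded_convergence_weighted[OF v])
    show "tensor (G n) \<in> borel_measurable cube_measure" for n
    proof -
      have "times_cont_diff (Suc 0) (\<phi> n)" using \<phi>_test by (auto simp: test_functions_def)
      then show ?thesis by (auto simp: d intro: continuous_imp_measurable_cube simp flip: d)
    qed
    show "(\<lambda>x. pi * real (k $ i) * cos_basis k x) \<in> borel_measurable cube_measure"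
      using measurable_cos_basis by measurable
    show "AE x in cube_measure. \<bar>tensor (G n) x\<bar> \<le> (\<Prod>j\<in>UNIV. if j = i then 7 * pi * real (k $ i) else 1)" for n
    proof (rule AE_I2, rule abs_tensor_le)
      fix x :: "real ^ 'd" and j assume "x \<in> space cube_measure"
      then have x: "0 \<le> x $ i" "x $ i \<le> 1" by (auto simp: mem_unit_cube)
      have "\<bar>pi * real (k $ i) * cos (pi * real (k $ i) * x $ i) * cutoff n (x $ i)\<bar> \<le> pi * real (k $ i) * 1 * 1"
        unfolding abs_mult by (intro mult_mono) (auto simp: cutoff_bounds)
      then have "\<bar>s' n (x $ i)\<bar> \<le> 7 * pi * real (k $ i)"
        using abs_sin_cutoff'_le[OF x, of "k $ i" n] unfolding s'_def
        by (simp add: mult.commute[of "cutoff' _ _"])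
      moreover have "\<bar>sine_at i k j t * cutoff n t\<bar> \<le> 1" for t
        using mult_mono[OF abs_sine_at_le[of i k j t] cutoff_bounds(2)[of n t]]
        by (simp add: abs_mult cutoff_bounds)
      ultimately show "\<bar>G n j (x $ j)\<bar> \<le> (if j = i then 7 * pi * real (k $ i) else 1)"
        by (simp add: G_def)
    qed
    show "AE x in cube_measure. (\<lambda>n. tensor (G n) x) \<longlonglongrightarrow> pi * real (k $ i) * cos_basis k x"
      using AE_cube_interior
    proof eventually_elim
      case (elim x)
      have "(\<lambda>n. s' n (x $ i)) \<longlonglongrightarrow> pi * real (k $ i) * cos (pi * real (k $ i) * x $ i) * 1
          + 0 * sin (pi * real (k $ i) * x $ i)"
        unfolding s'_def using elim by (intro tendsto_intros cutoff_tendsto cutoff'_tendsto) auto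
      moreover have sc: "(\<lambda>n. sine_at i k j (x $ j) * cutoff n (x $ j)) \<longlonglongrightarrow> sine_at i k j (x $ j) * 1" for j
        using elim by (intro tendsto_mult tendsto_const cutoff_tendsto) auto
      ultimately have G: "(\<lambda>n. G n j (x $ j)) \<longlonglongrightarrow>
          ((cosines k)(i := \<lambda>t. pi * real (k $ i) * cosines k i t)) j (x $ j)" for j
        using sc[of j] by (cases "j = i") (simp_all add: G_def sine_at_def cosines_def)
      have "(\<lambda>n. tensor (G n) x) \<longlonglongrightarrow>
          tensor ((cosines k)(i := \<lambda>t. pi * real (k $ i) * cosines k i t)) x"
        by (intro tensor_tendsto G)
      then show ?case
        by (simp only: tensor_upd_scale cos_basis_eq_tensor fun_upd_triv)
    qed
  qed
  moreover have "(LINT x|cube_measure. v x * tensor (G n) x) = - (LINT x|cube_measure. h x * \<phi> n x)" for n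
    using weak[OF \<phi>_test] by (simp add: d)
  ultimately have "(LINT x|cube_measure. v x * (pi * real (k $ i) * cos_basis k x)) =
      - (LINT x|cube_measure. h x * sin_basis i k x)"
    by (simp only:) (rule LIMSEQ_unique[OF _ tendsto_minus])
  then show ?thesis
    by (simp add: mult.left_commute[of "v _"])
qed

section \<open>Classical gradients are weak gradients\<close>

text \<open>
  Translation invariance of the Lebesgue measure makes the integral of every difference quotient
  of \<open>h\<close> in direction \<open>e\<close> zero, and by the mean value theorem these quotients are dominated by the
  supremum of \<open>\<bar>h'\<bar>\<close> on a fixed ball. This avoids iterated integrals.
\<close>

lemma integral_directional_derivative_eq_0:
  fixes h h' :: "'a::euclidean_space \<Rightarrow> real"
  assumes deriv: "\<And>x. ((\<lambda>t. h (x + t *\<^sub>R e)) has_real_derivative h' x) (at 0)"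
    and cont: "continuous_on UNIV h" "continuous_on UNIV h'"
    and K: "compact K" "\<And>x. x \<notin> K \<Longrightarrow> h x = 0"
  shows "(LINT x|lborel. h' x) = 0"
proof -
  have deriv_line: "((\<lambda>t. h (x + t *\<^sub>R e)) has_real_derivative h' (x + t *\<^sub>R e)) (at t)" for x t
    using deriv[of "x + t *\<^sub>R e"] DERIV_shift[of "\<lambda>t. h (x + t *\<^sub>R e)" "h' (x + t *\<^sub>R e)" 0 t]
    by (simp add: scaleR_left_distrib add_ac)
  \<comment> \<open>Near such a point \<open>h\<close> vanishes on a segment of the line in direction \<open>e\<close>.\<close>
  have h'0: "h' x = 0" if "x \<notin> K" for x
  proof -
    have "open ((\<lambda>t. x + t *\<^sub>R e) -` (- K))"
      using K(1) by (intro open_vimage continuous_intros) (auto dest: compact_imp_closed)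
    moreover have "0 \<in> (\<lambda>t. x + t *\<^sub>R e) -` (- K)" using that by simp
    ultimately have "((\<lambda>t. h (x + t *\<^sub>R e)) has_real_derivative 0) (at 0)"
      by (rule has_field_derivative_transform_within_open[OF DERIV_const[of 0]]) (simp add: K(2))
    then show ?thesis using deriv DERIV_unique by blast
  qed
  \<comment> \<open>The steps of the quotients have length at most \<open>norm e\<close>, so all quotients vanish outside the
    ball of radius \<open>R + norm e\<close>.\<close>
  obtain R where R: "\<And>x. x \<in> K \<Longrightarrow> norm x \<le> R"
    using compact_imp_bounded[OF K(1)] by (auto simp: bounded_iff)
  have "bounded (h' ` K)" "bounded (h ` K)"
    using K(1) cont by (auto intro!: compact_imp_bounded compact_continuous_image intro: continuous_on_subset)
  then obtain C1 C2 where "\<And>x. x \<in> K \<Longrightarrow> \<bar>h' x\<bar> \<le> C1" "\<And>x. x \<in> K \<Longrightarrow> \<bar>h x\<bar> \<le> C2"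
    by (auto simp: bounded_iff)
  then have C1: "\<bar>h' x\<bar> \<le> max C1 0" and C2: "\<bar>h x\<bar> \<le> max C2 0" for x
    using h'0 K(2) by (cases "x \<in> K"; force)+
  have [measurable]: "h \<in> borel_measurable borel" "h' \<in> borel_measurable borel"
    using cont by (auto intro: borel_measurable_continuous_onI)
  have int_h: "integrable lborel h"
  proof (rule Bochner_Integration.integrable_bound)
    show "integrable lborel (\<lambda>x. max C2 0 * indicator (cball 0 R) x :: real)"
      by (intro integrable_mult_right integrable_real_indicator) (use emeasure_bounded_finite[OF bounded_cball] in auto)
    show "AE x in lborel. norm (h x) \<le> norm (max C2 0 * indicator (cball 0 R) x)"
      using C2 R K(2) by (auto simp: indicator_def)
  qed simp
  define q where "q n x = (h (x + (1 / real (Suc n)) *\<^sub>R e) - h x) / (1 / real (Suc n))" for n x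
  have shift: "integrable lborel (\<lambda>x. h (x + v))" "(LINT x|lborel. h (x + v)) = (LINT x|lborel. h x)" for v
  proof -
    have "integrable (distr lborel borel ((+) v)) h"
      using int_h by (simp add: lborel_distr_plus)
    then show "integrable lborel (\<lambda>x. h (x + v))"
      by (simp add: integrable_distr_eq add.commute)
    have "(LINT x|lborel. h x) = (LINT x|distr lborel borel ((+) v). h x)"
      by (simp add: lborel_distr_plus)
    then show "(LINT x|lborel. h (x + v)) = (LINT x|lborel. h x)"
      by (simp add: integral_distr add.commute)
  qed
  have q0: "(LINT x|lborel. q n x) = 0" for n
    using int_h unfolding q_def by (simp add: shift)
  have "(\<lambda>n. LINT x|lborel. q n x) \<longlonglongrightarrow> (LINT x|lborel. h' x)"
  proof (rule integral_dominated_convergence[where w = "\<lambda>x. max C1 0 * indicator (cball 0 (R + norm e)) x"])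
    show "integrable lborel (\<lambda>x. max C1 0 * indicator (cball 0 (R + norm e)) x :: real)"
      by (intro integrable_mult_right integrable_real_indicator) (use emeasure_bounded_finite[OF bounded_cball] in auto)
    show "AE x in lborel. (\<lambda>n. q n x) \<longlonglongrightarrow> h' x"
    proof (rule AE_I2)
      fix x
      have "((\<lambda>t. (h (x + t *\<^sub>R e) - h x) / t) \<longlongrightarrow> h' x) (at 0)"
        using deriv[of x] by (simp add: DERIV_def)
      moreover have "filterlim (\<lambda>n. 1 / real (Suc n)) (at 0) sequentially"
        unfolding filterlim_at using LIMSEQ_inverse_real_of_nat by (auto simp: inverse_eq_divide)
      ultimately show "(\<lambda>n. q n x) \<longlonglongrightarrow> h' x"
        unfolding q_def by (rule filterlim_compose)
    qed
    show "AE x in lborel. norm (q n x) \<le> max C1 0 * indicator (cball 0 (R + norm e)) x" for n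
    proof (rule AE_I2)
      fix x
      define d where "d = 1 / real (Suc n)"
      have d: "0 < d" "d \<le> 1" by (auto simp: d_def)
      have qd: "q n x = (h (x + d *\<^sub>R e) - h x) / d" by (simp only: q_def d_def)
      show "norm (q n x) \<le> max C1 0 * indicator (cball 0 (R + norm e)) x"
      proof (cases "norm x \<le> R + norm e")
        case True
        obtain z where "h (x + d *\<^sub>R e) - h (x + 0 *\<^sub>R e) = (d - 0) * h' (x + z *\<^sub>R e)"
          using MVT2[OF d(1), of "\<lambda>t. h (x + t *\<^sub>R e)" "\<lambda>t. h' (x + t *\<^sub>R e)"] deriv_line by blast
        then have "q n x = h' (x + z *\<^sub>R e)"
          using d by (simp add: qd)
        then show ?thesis using C1 True by (simp add: indicator_def)
      next
        case False
        have "norm x \<le> norm (x + d *\<^sub>R e) + norm (d *\<^sub>R e)"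
          using norm_triangle_ineq4[of "x + d *\<^sub>R e" "d *\<^sub>R e"] by simp
        moreover have "norm (d *\<^sub>R e) \<le> norm e"
          using d by (simp add: mult_left_le_one_le)
        ultimately have "x + d *\<^sub>R e \<notin> K" "x \<notin> K"
          using False R[of "x + d *\<^sub>R e"] R[of x] norm_ge_zero[of e] by linarith+
        then show ?thesis by (simp add: qd K(2))
      qed
    qed
  qed (simp_all add: q_def)
  then show ?thesis
    by (simp add: q0 LIMSEQ_const_iff)
qed

text \<open>
  Passes between the cube, where the statements live, and the whole space, where translations
  are available.
\<close>

lemma integral_cube_eq_lborel:
  assumes "F \<in> borel_measurable borel" "\<And>x. x \<notin> unit_cube \<Longrightarrow> F x = 0"
  shows "(LINT x|cube_measure. F x) = (LINT x|lborel. F x :: real)"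
proof -
  have "(LINT x|cube_measure. F x) = (LINT x|lebesgue. indicator unit_cube x *\<^sub>R F x)"
    by (intro integral_restrict_space) simp
  also have "(\<lambda>x. indicator unit_cube x *\<^sub>R F x) = F"
    by (rule ext) (use assms(2) in \<open>auto simp: indicator_def\<close>)
  also have "(LINT x|lebesgue. F x) = (LINT x|lborel. F x)"
    using assms(1) by (intro integral_completion) simp
  finally show ?thesis .
qed

lemma DERIV_along_axis:
  assumes "\<phi> differentiable (at x)"
  shows "((\<lambda>t. \<phi> (x + t *\<^sub>R axis i 1)) has_real_derivative partial_deriv i \<phi> x) (at 0)"
proof -
  let ?D = "frechet_derivative \<phi> (at x)"
  have D: "(\<phi> has_derivative ?D) (at x)"
    using assms by (simp add: frechet_derivative_works)
  have "((\<lambda>t::real. x + t *\<^sub>R axis i 1) has_derivative (\<lambda>t. t *\<^sub>R axis i 1)) (at 0)"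
    by (auto intro!: derivative_eq_intros)
  from has_derivative_compose[OF this, of \<phi> ?D] D
  have "((\<lambda>t. \<phi> (x + t *\<^sub>R axis i 1)) has_derivative (\<lambda>t. ?D (t *\<^sub>R axis i 1))) (at 0)"
    by simp
  moreover have "?D (t *\<^sub>R axis i 1) = partial_deriv i \<phi> x * t" for t
    using linear_frechet_derivative[OF assms] by (simp add: linear_cmul partial_deriv_def)
  ultimately show ?thesis
    by (simp add: has_field_derivative_def)
qed

lemma test_functionD:
  assumes "\<phi> \<in> test_functions"
  shows "\<phi> differentiable (at x)" "continuous_on UNIV \<phi>" "continuous_on UNIV (partial_deriv i \<phi>)"
    "x \<notin> unit_cube \<Longrightarrow> \<phi> x = 0"
proof -
  have "times_cont_diff (Suc 0) \<phi>" using assms by (auto simp: test_functions_def)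
  then show "\<phi> differentiable (at x)" "continuous_on UNIV (partial_deriv i \<phi>)" by auto
  have "times_cont_diff 0 \<phi>" using assms by (auto simp: test_functions_def simp del: times_cont_diff.simps)
  then show "continuous_on UNIV \<phi>" by simp
  have "{x. \<phi> x \<noteq> 0} \<subseteq> unit_cube"
    using assms closure_subset[of "{x. \<phi> x \<noteq> 0}"] interior_subset[of unit_cube]
    unfolding test_functions_def by blast
  then show "x \<notin> unit_cube \<Longrightarrow> \<phi> x = 0" by auto
qed

text \<open>
  The product rule applied to \<open>u \<phi>\<close>, whose \<open>i\<close>-th derivative integrates to zero.
\<close>

lemma integral_by_parts_test_function:
  fixes u :: "real ^ 'd \<Rightarrow> real"
  assumes u: "\<And>x. u differentiable (at x)" "continuous_on UNIV u" "continuous_on UNIV (partial_deriv i u)"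
    and \<phi>: "\<phi> \<in> test_functions"
  shows "(LINT x|cube_measure. u x * partial_deriv i \<phi> x) =
    - (LINT x|cube_measure. partial_deriv i u x * \<phi> x)"
proof -
  note \<phi>D = test_functionD[OF \<phi>]
  let ?h' = "\<lambda>x. u x * partial_deriv i \<phi> x + partial_deriv i u x * \<phi> x"
  have cont: "continuous_on UNIV ?h'"
    by (intro continuous_intros u \<phi>D)
  have deriv: "((\<lambda>t. u (x + t *\<^sub>R axis i 1) * \<phi> (x + t *\<^sub>R axis i 1)) has_real_derivative ?h' x) (at 0)" for x
    using DERIV_mult[OF DERIV_along_axis[OF u(1)] DERIV_along_axis[OF \<phi>D(1)], of x i x i]
    by (simp add: algebra_simps)
  have "(LINT x|lborel. ?h' x) = 0"
    by (rule integral_directional_derivative_eq_0[OF deriv _ cont, of unit_cube])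
       (auto intro!: continuous_intros u \<phi>D simp: unit_cube_def)
  moreover have "?h' x = 0" if "x \<notin> unit_cube" for x
  proof -
    have "open (- unit_cube)" by (simp add: unit_cube_def open_Compl closed_cbox)
    then have "(\<phi> has_derivative (\<lambda>_. 0)) (at x)"
      using that \<phi>D(4) by (intro has_derivative_transform_within_open[OF has_derivative_const[of 0]]) auto
    then have "partial_deriv i \<phi> x = 0"
      unfolding partial_deriv_def by (simp flip: frechet_derivative_at)
    then show ?thesis using that \<phi>D(4) by simp
  qed
  ultimately have sum0: "(LINT x|cube_measure. ?h' x) = 0"
    using cont by (subst integral_cube_eq_lborel) (auto intro: borel_measurable_continuous_onI)
  have "(LINT x|cube_measure. ?h' x) =
      (LINT x|cube_measure. u x * partial_deriv i \<phi> x) + (LINT x|cube_measure. partial_deriv i u x * \<phi> x)"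
    by (intro Bochner_Integration.integral_add integrable_cube_continuous continuous_intros u \<phi>D)
  with sum0 show ?thesis by linarith
qed

lemma L2_cube_imp_integrable:
  assumes "u \<in> L2_cube" shows "integrable cube_measure u"
proof (rule Bochner_Integration.integrable_bound)
  interpret finite_measure cube_measure by (rule finite_cube_measure)
  show "integrable cube_measure (\<lambda>x. 1 + (u x)\<^sup>2)"
    using assms by (simp add: L2_cube_def)
  have b: "\<bar>t\<bar> \<le> 1 + t\<^sup>2" for t :: real
    using zero_le_power2[of "\<bar>t\<bar> - 1"] abs_ge_zero[of t] unfolding power2_diff power2_abs one_power2 by linarith
  show "AE x in cube_measure. norm (u x) \<le> norm (1 + (u x)\<^sup>2)"
    unfolding real_norm_def by (intro AE_I2 order_trans[OF b abs_ge_self])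
qed (use assms in \<open>simp add: L2_cube_def\<close>)

lemma bounded_imp_L2_cube:
  assumes "u \<in> borel_measurable cube_measure" "\<And>x. \<bar>u x\<bar> \<le> C"
  shows "u \<in> L2_cube"
proof -
  interpret finite_measure cube_measure by (rule finite_cube_measure)
  have "(u x)\<^sup>2 \<le> C\<^sup>2" for x
    using power_mono[OF assms(2)[of x], of 2] by simp
  then have "integrable cube_measure (\<lambda>x. (u x)\<^sup>2)"
    by (intro integrable_const_bound[where B = "C\<^sup>2"] AE_I2 borel_measurable_power assms(1)) simp
  then show ?thesis using assms by (simp add: L2_cube_def)
qed

lemma partial_deriv_cos_basis:
  "partial_deriv i (cos_basis k) = (\<lambda>x. - (pi * real (k $ i)) * sin_basis i k x)"
proof -
  have "(cosines k j has_real_derivative - (pi * real (k $ j)) * sin (pi * real (k $ j) * t)) (at t)" for j t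
    unfolding cosines_def by (auto intro!: derivative_eq_intros)
  from partial_deriv_tensor[of "cosines k" "\<lambda>j t. - (pi * real (k $ j)) * sin (pi * real (k $ j) * t)", OF this]
  show ?thesis
    by (simp only: cos_basis_eq_tensor tensor_upd_scale sin_basis_def sine_at_def fun_eq_iff simp_thms)
qed

lemma cos_basis_differentiable: "cos_basis k differentiable (at x)"
proof -
  have "times_cont_diff (Suc 0) (cos_basis k)"
    unfolding cos_basis_eq_tensor by (intro times_cont_diff_tensor smooth_upto_cosines)
  then show ?thesis by simp
qed

lemma cos_basis_by_parts:
  assumes "\<phi> \<in> test_functions"
  shows "(LINT x|cube_measure. cos_basis k x * partial_deriv i \<phi> x) =
    pi * real (k $ i) * (LINT x|cube_measure. sin_basis i k x * \<phi> x)"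
proof -
  have c: "continuous_on UNIV (partial_deriv i (cos_basis k))"
    unfolding partial_deriv_cos_basis by (intro continuous_intros continuous_on_sin_basis)
  show ?thesis
    unfolding integral_by_parts_test_function[OF cos_basis_differentiable continuous_on_cos_basis c assms]
    by (simp add: partial_deriv_cos_basis mult.assoc)
qed

section \<open>Completeness and orthogonality of the cosine products\<close>

text \<open>
  The algebra generated by the functions \<open>cos (\<pi> x\<^sub>i)\<close>, to which the Stone--Weierstrass theorem
  will be applied.
\<close>

inductive cos_poly :: "(real ^ 'd \<Rightarrow> real) \<Rightarrow> bool" where
  const: "cos_poly (\<lambda>_. c)"
| coord: "cos_poly (\<lambda>x. cos (pi * x $ i))"
| add: "cos_poly p \<Longrightarrow> cos_poly q \<Longrightarrow> cos_poly (\<lambda>x. p x + q x)"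
| mult: "cos_poly p \<Longrightarrow> cos_poly q \<Longrightarrow> cos_poly (\<lambda>x. p x * q x)"

lemma continuous_on_cos_poly: "cos_poly p \<Longrightarrow> continuous_on S p"
  by (induction rule: cos_poly.induct) (auto intro!: continuous_intros)

text \<open>
  The formula \<open>cos a cos b = (cos (a + b) + cos (a - b)) / 2\<close> in the \<open>i\<close>-th coordinate. For
  \<open>k\<^sub>i = 0\<close> the lower frequency \<open>- 1\<close> is replaced by \<open>1\<close>, as the cosine is even.
\<close>

lemma cos_coord_mult_cos_basis:
  "cos (pi * x $ i) * cos_basis k x =
    (cos_basis (\<chi> j. if j = i then k $ i + 1 else k $ j) x
     + cos_basis (\<chi> j. if j = i then (if k $ i = 0 then 1 else k $ i - 1) else k $ j) x) / 2"
proof -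
  have upd: "cosines (\<chi> j. if j = i then m else k $ j) = (cosines k)(i := \<lambda>t. cos (pi * real m * t))" for m
    by (auto simp: cosines_def fun_eq_iff)
  have k: "cosines k = (cosines k)(i := \<lambda>t. cos (pi * real (k $ i) * t))"
    by (auto simp: cosines_def fun_eq_iff)
  let ?m = "if k $ i = 0 then 1 else k $ i - 1 :: nat"
  have "cos (pi * x $ i) * cos (pi * real (k $ i) * x $ i) =
      (cos (pi * real (k $ i + 1) * x $ i) + cos (pi * real ?m * x $ i)) / 2"
  proof (cases "k $ i = 0")
    case False
    then have m: "real ?m = real (k $ i) - 1" by (simp add: of_nat_diff)
    have "cos (pi * real (k $ i + 1) * x $ i) = cos (pi * real (k $ i) * x $ i + pi * x $ i)"
      "cos (pi * real ?m * x $ i) = cos (pi * real (k $ i) * x $ i - pi * x $ i)"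
      unfolding m by (simp_all add: algebra_simps)
    then show ?thesis by (simp add: cos_add cos_diff)
  qed simp
  moreover have "a * b = (c + d) / 2 \<Longrightarrow> a * (b * P) = (c * P + d * P) / 2" for a b c d P :: real
    by (metis distrib_right mult.assoc times_divide_eq_left)
  ultimately show ?thesis
    unfolding cos_basis_eq_tensor upd by (subst k) (simp only: tensor_upd)
qed

text \<open>
  The integrable functions that annihilate all cosine products are closed under multiplication by
  \<open>cos (\<pi> x\<^sub>i)\<close>, hence by the whole algebra.
\<close>

lemma annihilator_mult_cos_poly:
  fixes w :: "real ^ 'd::finite \<Rightarrow> real"
  assumes "cos_poly p" "integrable cube_measure w" "\<And>k. (LINT x|cube_measure. w x * cos_basis k x) = 0"
  shows "integrable cube_measure (\<lambda>x. w x * p x)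
    \<and> (\<forall>k. (LINT x|cube_measure. (w x * p x) * cos_basis k x) = 0)"
  using assms
proof (induction arbitrary: w rule: cos_poly.induct)
  case (const c)
  have "(LINT x|cube_measure. w x * c * cos_basis k x) = c * (LINT x|cube_measure. w x * cos_basis k x)" for k
    by (subst integral_mult_right_zero[symmetric]) (simp add: mult_ac)
  then show ?case using const by simp
next
  case (coord i)
  have int: "integrable cube_measure (\<lambda>x. w x * cos_basis k x)" for k
    by (rule integrable_mult_bounded[OF coord(1) measurable_cos_basis, where C = 1]) (simp add: abs_cos_basis_le)
  have "integrable cube_measure (\<lambda>x. w x * cos (pi * x $ i))"
    by (rule integrable_mult_bounded[OF coord(1), where C = 1])
       (auto intro!: continuous_imp_measurable_cube continuous_intros)
  moreover have "(LINT x|cube_measure. (w x * cos (pi * x $ i)) * cos_basis k x) = 0" for k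
    unfolding mult.assoc cos_coord_mult_cos_basis
    using int coord(2) by (simp add: distrib_left add_divide_distrib)
  ultimately show ?case by blast
next
  case (add p q)
  note p = add.IH(1)[OF add.prems] and q = add.IH(2)[OF add.prems]
  have int: "integrable cube_measure (\<lambda>x. w x * p x * cos_basis k x)"
    "integrable cube_measure (\<lambda>x. w x * q x * cos_basis k x)" for k
    using p q by (auto intro!: integrable_mult_bounded[OF _ measurable_cos_basis, where C = 1] simp: abs_cos_basis_le)
  show ?case
    using p q int by (simp add: distrib_left distrib_right)
next
  case (mult p q)
  from mult.IH(1)[OF mult.prems] have "integrable cube_measure (\<lambda>x. w x * p x)"
    "\<And>k. (LINT x|cube_measure. (w x * p x) * cos_basis k x) = 0" by auto
  from mult.IH(2)[OF this] show ?case by (simp add: mult.assoc)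
qed

lemma cos_basis_0: "cos_basis 0 x = 1"
  by (simp add: cos_basis_def)

text \<open>
  The points of the cube are separated because the cosine is injective on \<open>[0, \<pi>]\<close>.
\<close>

lemma cos_poly_approx:
  fixes h :: "real ^ 'd::finite \<Rightarrow> real"
  assumes "continuous_on unit_cube h" "0 < e"
  shows "\<exists>p. cos_poly p \<and> (\<forall>x\<in>unit_cube. \<bar>h x - p x\<bar> < e)"
proof (rule Stone_Weierstrass_HOL[where P = cos_poly and S = unit_cube])
  show "\<exists>p. cos_poly p \<and> p x \<noteq> p y"
    if xy: "x \<in> unit_cube \<and> y \<in> unit_cube \<and> x \<noteq> y" for x y :: "real ^ 'd"
  proof -
    obtain i where i: "x $ i \<noteq> y $ i" using xy by (auto simp: vec_eq_iff)
    have "pi * x $ i \<in> {0..pi}" "pi * y $ i \<in> {0..pi}"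
      using xy by (auto simp: mem_unit_cube)
    then have "cos (pi * x $ i) \<noteq> cos (pi * y $ i)"
      using cos_inj_pi[of "pi * x $ i" "pi * y $ i"] i by auto
    then show ?thesis using cos_poly.coord[of i] by (intro exI[of _ "\<lambda>x. cos (pi * x $ i)"]) simp
  qed
qed (use assms in \<open>auto simp: unit_cube_def intro: cos_poly.intros continuous_on_cos_poly\<close>)

text \<open>
  By \<open>annihilator_mult_cos_poly\<close>, at \<open>k = 0\<close>, the function \<open>w\<close> annihilates the algebra, and by
  Stone--Weierstrass every continuous function. The sign of \<open>w\<close> is almost everywhere a limit of
  continuous functions with values in \<open>[-1, 1]\<close>, so the integral of \<open>\<bar>w\<bar>\<close> vanishes.
\<close>

lemma cos_basis_complete:
  fixes w :: "real ^ 'd::finite \<Rightarrow> real"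
  assumes w: "integrable cube_measure w"
    and zero: "\<And>k. (LINT x|cube_measure. w x * cos_basis k x) = 0"
  shows "AE x in cube_measure. w x = 0"
proof -
  have cont: "(LINT x|cube_measure. w x * h x) = 0"
    if h: "continuous_on UNIV h" "\<And>x. \<bar>h x\<bar> \<le> 1" for h :: "real ^ 'd \<Rightarrow> real"
  proof -
    define I where "I = (LINT x|cube_measure. \<bar>w x\<bar>)"
    have wh: "integrable cube_measure (\<lambda>x. w x * h x)"
      by (rule integrable_mult_bounded[OF w continuous_imp_measurable_cube[OF h(1)], where C = 1]) (simp add: h(2))
    have small: "\<bar>LINT x|cube_measure. w x * h x\<bar> \<le> e * I" if "e > 0" for e
    proof -
      obtain p where p: "cos_poly p" "\<And>x. x \<in> unit_cube \<Longrightarrow> \<bar>h x - p x\<bar> < e"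
        using cos_poly_approx[of h e] h \<open>e > 0\<close> continuous_on_subset by blast
      have wp: "integrable cube_measure (\<lambda>x. w x * p x)" "(LINT x|cube_measure. w x * p x) = 0"
        using annihilator_mult_cos_poly[OF p(1) w zero] by (auto simp: cos_basis_0 dest: spec[of _ 0])
      have "(LINT x|cube_measure. w x * h x) = (LINT x|cube_measure. w x * h x - w x * p x)"
        using wh wp by simp
      also have "\<bar>\<dots>\<bar> \<le> (LINT x|cube_measure. \<bar>w x * h x - w x * p x\<bar>)"
        by (rule integral_abs_bound)
      also have "\<dots> \<le> (LINT x|cube_measure. e * \<bar>w x\<bar>)"
      proof (rule integral_mono)
        fix x :: "real ^ 'd" assume "x \<in> space cube_measure"
        then have "\<bar>h x - p x\<bar> \<le> e" using p(2)[of x] by simp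
        then have "\<bar>w x\<bar> * \<bar>h x - p x\<bar> \<le> \<bar>w x\<bar> * e" by (intro mult_left_mono) auto
        then show "\<bar>w x * h x - w x * p x\<bar> \<le> e * \<bar>w x\<bar>"
          by (simp only: abs_mult mult.commute[of e] flip: right_diff_distrib)
      qed (use w wh wp in auto)
      finally show ?thesis by (simp add: I_def)
    qed
    have "I \<ge> 0" unfolding I_def by simp
    have "\<bar>LINT x|cube_measure. w x * h x\<bar> \<le> 0"
    proof (rule field_le_epsilon)
      fix e :: real assume "e > 0"
      have "\<bar>LINT x|cube_measure. w x * h x\<bar> \<le> e / (I + 1) * I"
        using \<open>e > 0\<close> \<open>I \<ge> 0\<close> by (intro small) auto
      also have "\<dots> \<le> e" using \<open>e > 0\<close> \<open>I \<ge> 0\<close> by (simp add: field_simps)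
      finally show "\<bar>LINT x|cube_measure. w x * h x\<bar> \<le> 0 + e" by simp
    qed
    then show ?thesis by simp
  qed
  have wm: "w \<in> borel_measurable cube_measure" using w by auto
  have sgn_m: "(\<lambda>x. sgn (w x)) \<in> borel_measurable cube_measure"
    using wm by measurable
  define f where "f x = (if x \<in> unit_cube then sgn (w x) else 0)" for x :: "real ^ 'd"
  have "f \<in> borel_measurable lebesgue"
    unfolding f_def using sgn_m by (subst borel_measurable_if) auto
  then have "f measurable_on UNIV"
    by (rule lebesgue_measurable_imp_measurable_on) simp
  then obtain N g where N: "negligible N" and g: "\<And>n. continuous_on UNIV (g n)"
    "\<And>x. x \<notin> N \<Longrightarrow> (\<lambda>n. g n x) \<longlonglongrightarrow> f x"
    unfolding measurable_on_def by auto
  \<comment> \<open>Truncation supplies the uniform bound and leaves the limit unchanged.\<close>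
  define h where "h n x = max (-1) (min 1 (g n x))" for n and x :: "real ^ 'd"
  have hc: "continuous_on UNIV (h n)" for n
    unfolding h_def by (intro continuous_intros g)
  have h1: "\<bar>h n x\<bar> \<le> 1" for n x by (auto simp: h_def)
  have "(\<lambda>n. LINT x|cube_measure. w x * h n x) \<longlonglongrightarrow> (LINT x|cube_measure. w x * sgn (w x))"
  proof (rule bounded_convergence_weighted[OF w _ sgn_m])
    show "h n \<in> borel_measurable cube_measure" for n
      by (rule continuous_imp_measurable_cube[OF hc])
    show "AE x in cube_measure. \<bar>h n x\<bar> \<le> 1" for n by (simp add: h1)
    show "AE x in cube_measure. (\<lambda>n. h n x) \<longlonglongrightarrow> sgn (w x)"
    proof (rule AE_cube_if_negligible[OF N])
      fix x :: "real ^ 'd" assume x: "x \<in> unit_cube" "x \<notin> N"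
      have "(\<lambda>n. h n x) \<longlonglongrightarrow> max (-1) (min 1 (f x))"
        unfolding h_def by (intro tendsto_intros g x)
      also have "max (-1) (min 1 (f x)) = sgn (w x)"
        using x by (auto simp: f_def sgn_if)
      finally show "(\<lambda>n. h n x) \<longlonglongrightarrow> sgn (w x)" .
    qed
  qed
  then have "(LINT x|cube_measure. w x * sgn (w x)) = 0"
    by (simp add: cont[OF hc h1] LIMSEQ_const_iff)
  then have "(LINT x|cube_measure. \<bar>w x\<bar>) = 0"
    by (simp add: abs_sgn)
  then have "AE x in cube_measure. \<bar>w x\<bar> = 0"
    using w by (subst (asm) integral_nonneg_eq_0_iff_AE) auto
  then show ?thesis by simp
qed

text \<open>
  Continuity suffices: the cosine product equals \<open>1\<close> at the origin.
\<close>

lemma integral_cos_basis_square_pos: "0 < (LINT x|cube_measure. (cos_basis k x)\<^sup>2)"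
proof -
  have cont: "continuous_on S (\<lambda>x. (cos_basis k x)\<^sup>2)" for S
    by (intro continuous_intros continuous_on_cos_basis)
  have eq: "(LINT x|cube_measure. (cos_basis k x)\<^sup>2) = integral (cbox 0 1) (\<lambda>x. (cos_basis k x)\<^sup>2)"
    using integrable_cube_continuous[OF cont] unfolding unit_cube_def
    by (intro lebesgue_integral_eq_integral) auto
  have "(1 :: real ^ 'a) \<bullet> b > 0" if "b \<in> Basis" for b
    using that by (auto simp: Basis_vec_def inner_axis)
  then have ne: "box 0 (1 :: real ^ 'a) \<noteq> {}"
    by (simp add: box_ne_empty)
  have z: "(0 :: real ^ 'a) \<in> cbox 0 1" by (simp add: mem_box_cart)
  have "cos_basis k 0 = 1" by (simp add: cos_basis_def)
  then have "\<not> (\<forall>x\<in>cbox 0 1. (cos_basis k x)\<^sup>2 = 0)"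
    using z by force
  then have "(LINT x|cube_measure. (cos_basis k x)\<^sup>2) \<noteq> 0"
    unfolding eq using integral_cbox_eq_0_iff[OF cont ne] by simp
  moreover have "0 \<le> (LINT x|cube_measure. (cos_basis k x)\<^sup>2)" by simp
  ultimately show ?thesis by linarith
qed

text \<open>
  One integration by parts, in which the classical gradient of \<open>cos_basis l\<close> is paired with
  \<open>sin_basis i k\<close>.
\<close>

lemma sin_basis_cos_basis_relation:
  "real (l $ i) * (LINT x|cube_measure. sin_basis i l x * sin_basis i k x) =
   real (k $ i) * (LINT x|cube_measure. cos_basis l x * cos_basis k x)"
proof -
  have "(LINT x|cube_measure. (- (pi * real (l $ i)) * sin_basis i l x) * sin_basis i k x) =
      - (pi * real (k $ i)) * (LINT x|cube_measure. cos_basis l x * cos_basis k x)"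
    by (rule weak_derivative_against_sin_basis)
       (auto intro!: integrable_cube_continuous continuous_on_cos_basis continuous_on_sin_basis
          simp: cos_basis_by_parts mult.assoc)
  then have "pi * (real (l $ i) * (LINT x|cube_measure. sin_basis i l x * sin_basis i k x)) =
      pi * (real (k $ i) * (LINT x|cube_measure. cos_basis l x * cos_basis k x))"
    by (simp add: mult.assoc)
  then show ?thesis by (rule mult_left_cancel[THEN iffD1, rotated]) simp
qed

text \<open>
  If \<open>k\<close> and \<open>l\<close> differ at \<open>i\<close>, the two products are eigenfunctions of \<open>\<partial>\<^sub>i\<^sup>2\<close> with different
  eigenvalues. Combining the preceding relation for \<open>(k, l)\<close> and for \<open>(l, k)\<close> eliminates the
  sine integral.
\<close>

lemma cos_basis_orthogonal:
  assumes "k \<noteq> l"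
  shows "(LINT x|cube_measure. cos_basis k x * cos_basis l x) = 0"
proof -
  obtain i where i: "k $ i \<noteq> l $ i" using assms by (auto simp: vec_eq_iff)
  define A where "A = (LINT x|cube_measure. sin_basis i k x * sin_basis i l x)"
  define B where "B = (LINT x|cube_measure. cos_basis k x * cos_basis l x)"
  have A: "real (k $ i) * A = real (l $ i) * B" "real (l $ i) * A = real (k $ i) * B"
    using sin_basis_cos_basis_relation[of k i l] sin_basis_cos_basis_relation[of l i k]
    by (simp_all add: A_def B_def mult.commute)
  have "real (k $ i) * (real (k $ i) * B) = real (k $ i) * (real (l $ i) * A)"
    by (simp only: A)
  also have "\<dots> = real (l $ i) * (real (k $ i) * A)"
    by (rule mult.left_commute)
  also have "\<dots> = real (l $ i) * (real (l $ i) * B)"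
    by (simp only: A)
  finally have "((real (k $ i))\<^sup>2 - (real (l $ i))\<^sup>2) * B = 0"
    by (simp add: power2_eq_square left_diff_distrib)
  moreover have "(real (k $ i))\<^sup>2 \<noteq> (real (l $ i))\<^sup>2"
    using i by simp
  ultimately show ?thesis by (simp add: B_def)
qed

section \<open>Cosine series\<close>

text \<open>
  Interchange of sum and integral. All series below have absolutely summable coefficients and
  uniformly bounded terms, and are integrated against some integrable \<open>w\<close>.
\<close>

lemma weighted_series_sums:
  fixes w :: "'a \<Rightarrow> real" and \<psi> :: "nat \<Rightarrow> 'a \<Rightarrow> real"
  assumes a: "summable (\<lambda>n. \<bar>a n\<bar>)" and w: "integrable M w"
    and \<psi>: "\<And>n. \<psi> n \<in> borel_measurable M" "\<And>n x. \<bar>\<psi> n x\<bar> \<le> 1"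
  shows "(\<lambda>n. a n * (LINT x|M. w x * \<psi> n x)) sums (LINT x|M. w x * (\<Sum>n. a n * \<psi> n x))"
proof -
  have le: "\<bar>a n * \<psi> n x\<bar> \<le> \<bar>a n\<bar>" for n x
    using mult_left_mono[OF \<psi>(2)[of n x], of "\<bar>a n\<bar>"] by (simp add: abs_mult)
  have sm: "summable (\<lambda>n. a n * \<psi> n x)" for x
    using le by (intro summable_comparison_test'[OF a]) simp
  have int: "integrable M (\<lambda>x. w x * \<psi> n x)" for n
    by (rule integrable_mult_bounded[OF w \<psi>(1), where C = 1]) (simp add: \<psi>(2))
  have "(\<lambda>N. LINT x|M. w x * (\<Sum>n<N. a n * \<psi> n x)) \<longlonglongrightarrow> (LINT x|M. w x * (\<Sum>n. a n * \<psi> n x))"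
  proof (rule bounded_convergence_weighted[OF w])
    show "AE x in M. \<bar>\<Sum>n<N. a n * \<psi> n x\<bar> \<le> (\<Sum>n. \<bar>a n\<bar>)" for N
    proof (rule AE_I2)
      fix x
      have "\<bar>\<Sum>n<N. a n * \<psi> n x\<bar> \<le> (\<Sum>n<N. \<bar>a n\<bar>)"
        using le by (intro order_trans[OF sum_abs] sum_mono)
      also have "\<dots> \<le> (\<Sum>n. \<bar>a n\<bar>)"
        by (rule sum_le_suminf[OF a]) auto
      finally show "\<bar>\<Sum>n<N. a n * \<psi> n x\<bar> \<le> (\<Sum>n. \<bar>a n\<bar>)" .
    qed
    show "AE x in M. (\<lambda>N. \<Sum>n<N. a n * \<psi> n x) \<longlonglongrightarrow> (\<Sum>n. a n * \<psi> n x)"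
      using summable_LIMSEQ[OF sm] by simp
  qed (use \<psi>(1) in measurable)
  moreover have "(LINT x|M. w x * (\<Sum>n<N. a n * \<psi> n x)) = (\<Sum>n<N. a n * (LINT x|M. w x * \<psi> n x))" for N
    using int by (simp add: sum_distrib_left mult.left_commute[of "w _"])
  ultimately show ?thesis by (simp add: sums_def)
qed

lemma abs_series_le:
  fixes a :: "nat \<Rightarrow> real"
  assumes a: "summable (\<lambda>n. \<bar>a n\<bar>)" and \<psi>: "\<And>n. \<bar>\<psi> n\<bar> \<le> 1"
  shows "\<bar>\<Sum>n. a n * \<psi> n\<bar> \<le> (\<Sum>n. \<bar>a n\<bar>)"
proof -
  have le: "\<bar>a n * \<psi> n\<bar> \<le> \<bar>a n\<bar>" for n
    using mult_left_mono[OF \<psi>[of n], of "\<bar>a n\<bar>"] by (simp add: abs_mult)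
  have "summable (\<lambda>n. \<bar>a n * \<psi> n\<bar>)"
    using le by (intro summable_comparison_test'[OF a]) simp
  then show ?thesis
    using le by (intro order_trans[OF summable_rabs] suminf_le a) auto
qed

text \<open>
  An enumeration of the multi-indices, which turns sums over \<^typ>\<open>nat ^ 'd\<close> into ordinary series.
\<close>

definition multi_index :: "nat \<Rightarrow> nat ^ 'd::finite" where
  "multi_index = from_nat_into UNIV"

lemma bij_multi_index: "bij (multi_index :: nat \<Rightarrow> nat ^ 'd::finite)"
proof -
  have "inj (\<lambda>n. (\<chi> i. n) :: nat ^ 'd)"
    by (auto simp: inj_def vec_eq_iff)
  then have "infinite (UNIV :: (nat ^ 'd) set)"
    using finite_subset[OF subset_UNIV] range_inj_infinite by blast
  then show ?thesis
    unfolding multi_index_def by (intro bij_betw_from_nat_into) auto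
qed

text \<open>
  Both sides are integrable and have the same cosine coefficients, by orthogonality. In particular
  an integrable function with summable coefficients is essentially bounded, so its products with
  square integrable functions are integrable.
\<close>

lemma cos_series_AE:
  fixes f :: "real ^ 'd::finite \<Rightarrow> real"
  assumes f: "integrable cube_measure f"
    and summ: "summable (\<lambda>n. \<bar>cos_coeff f (multi_index n)\<bar>)"
  shows "AE x in cube_measure. f x = (\<Sum>n. cos_coeff f (multi_index n) * cos_basis (multi_index n) x)"
proof -
  interpret finite_measure "cube_measure :: (real ^ 'd) measure" by (rule finite_cube_measure)
  define g where "g x = (\<Sum>n. cos_coeff f (multi_index n) * cos_basis (multi_index n) x)" for x :: "real ^ 'd"
  have gm: "g \<in> borel_measurable cube_measure"
    unfolding g_def using measurable_cos_basis by measurable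
  have g: "integrable cube_measure g"
    unfolding g_def
    by (intro integrable_const_bound[where B = "\<Sum>n. \<bar>cos_coeff f (multi_index n)\<bar>"] gm[unfolded g_def] AE_I2)
       (simp add: abs_series_le[OF summ abs_cos_basis_le])
  have "(LINT x|cube_measure. (f x - g x) * cos_basis k x) = 0" for k
  proof -
    obtain m where m: "multi_index m = k"
      using bij_multi_index by (metis bij_pointE)
    have "(\<lambda>n. cos_coeff f (multi_index n) * (LINT x|cube_measure. cos_basis k x * cos_basis (multi_index n) x))
        sums (LINT x|cube_measure. cos_basis k x * g x)"
      unfolding g_def
      by (rule weighted_series_sums[OF summ integrable_cube_continuous[OF continuous_on_cos_basis]
            measurable_cos_basis abs_cos_basis_le])
    moreover have "cos_coeff f (multi_index n) * (LINT x|cube_measure. cos_basis k x * cos_basis (multi_index n) x)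
        = (if n = m then (LINT x|cube_measure. f x * cos_basis k x) else 0)" for n
    proof (cases "n = m")
      case True
      then show ?thesis
        using integral_cos_basis_square_pos[of k] m by (simp add: cos_coeff_def power2_eq_square)
    next
      case False
      then have "multi_index n \<noteq> k"
        using m bij_is_inj[OF bij_multi_index] by (metis inj_eq)
      then show ?thesis using False by (simp add: cos_basis_orthogonal)
    qed
    ultimately have "(LINT x|cube_measure. cos_basis k x * g x) = (LINT x|cube_measure. f x * cos_basis k x)"
      using sums_unique2[OF _ sums_single[of m "\<lambda>_. LINT x|cube_measure. f x * cos_basis k x"]] by simp
    moreover have "integrable cube_measure (\<lambda>x. f x * cos_basis k x)" "integrable cube_measure (\<lambda>x. g x * cos_basis k x)"
      using f g by (auto intro!: integrable_mult_bounded[OF _ measurable_cos_basis, where C = 1] simp: abs_cos_basis_le)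
    ultimately show ?thesis
      by (simp add: left_diff_distrib mult.commute[of _ "g _"])
  qed
  then have "AE x in cube_measure. f x - g x = 0"
    using f g by (intro cos_basis_complete) auto
  then show ?thesis by (simp add: g_def)
qed

section \<open>Weak gradients\<close>

lemma has_weak_gradientD:
  assumes "has_weak_gradient u G"
  shows "integrable cube_measure (\<lambda>x. G x $ i)"
    and "(\<lambda>x. G x $ i) \<in> borel_measurable cube_measure"
    and "\<phi> \<in> test_functions \<Longrightarrow>
      (LINT x|cube_measure. u x * partial_deriv i \<phi> x) = - (LINT x|cube_measure. G x $ i * \<phi> x)"
  using assms L2_cube_imp_integrable[of "\<lambda>x. G x $ i"] by (auto simp: has_weak_gradient_def L2_cube_def)

text \<open>
  The difference of two weak gradients annihilates all test functions, hence all cosine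
  products, and completeness applies to each component.
\<close>

lemma weak_gradient_unique_AE:
  fixes u :: "real ^ 'd \<Rightarrow> real"
  assumes G: "has_weak_gradient u G" and H: "has_weak_gradient u H"
  shows "AE x in cube_measure. G x = H x"
proof -
  have "AE x in cube_measure. G x $ i - H x $ i = 0" for i
  proof (rule cos_basis_complete)
    show int: "integrable cube_measure (\<lambda>x. G x $ i - H x $ i)"
      by (intro Bochner_Integration.integrable_diff has_weak_gradientD(1)[OF G] has_weak_gradientD(1)[OF H])
    show "(LINT x|cube_measure. (G x $ i - H x $ i) * cos_basis k x) = 0" for k
    proof (rule orthogonal_to_cos_basis_if_orthogonal_to_test_functions[OF int])
      fix \<phi> :: "real ^ 'd \<Rightarrow> real" assume \<phi>: "\<phi> \<in> test_functions"
      obtain C where C: "\<And>x. x \<in> unit_cube \<Longrightarrow> \<bar>\<phi> x\<bar> \<le> C"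
      proof -
        have "compact (\<phi> ` unit_cube)"
          using test_functionD(2)[OF \<phi>] unfolding unit_cube_def
          by (intro compact_continuous_image) (auto intro: continuous_on_subset)
        then obtain C where "\<forall>x\<in>unit_cube. \<bar>\<phi> x\<bar> \<le> C"
          by (auto dest!: compact_imp_bounded simp: bounded_iff)
        then show ?thesis using that[of C] by blast
      qed
      have "integrable cube_measure (\<lambda>x. G x $ i * \<phi> x)" "integrable cube_measure (\<lambda>x. H x $ i * \<phi> x)"
        by (intro integrable_mult_bounded[where C = C] has_weak_gradientD(1)[OF G] has_weak_gradientD(1)[OF H]
            continuous_imp_measurable_cube test_functionD(2)[OF \<phi>] AE_I2 C; simp)+
      then show "(LINT x|cube_measure. (G x $ i - H x $ i) * \<phi> x) = 0"
        using has_weak_gradientD(3)[OF G \<phi>, of i] has_weak_gradientD(3)[OF H \<phi>, of i]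
        by (simp add: left_diff_distrib)
    qed
  qed
  then have "AE x in cube_measure. \<forall>i. G x $ i - H x $ i = 0"
    by (simp add: AE_all_countable)
  then show ?thesis by eventually_elim (simp add: vec_eq_iff)
qed

text \<open>
  Lets the gradients that \<^const>\<open>weak_gradient\<close> chooses be replaced by given ones, one of which is
  bounded so that the products are integrable.
\<close>

lemma integral_weak_gradients:
  fixes u v :: "real ^ 'd \<Rightarrow> real"
  assumes G: "has_weak_gradient u G" and H: "has_weak_gradient v H"
    and bound: "\<And>x i. \<bar>H x $ i\<bar> \<le> C"
  shows "(LINT x|cube_measure. weak_gradient u x \<bullet> weak_gradient v x) =
    (\<Sum>i\<in>UNIV. LINT x|cube_measure. G x $ i * H x $ i)"
proof -
  have wu: "has_weak_gradient u (weak_gradient u)" and wv: "has_weak_gradient v (weak_gradient v)"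
    unfolding weak_gradient_def using someI[of "has_weak_gradient u", OF G] someI[of "has_weak_gradient v", OF H] by blast+
  have "(LINT x|cube_measure. weak_gradient u x \<bullet> weak_gradient v x) =
      (LINT x|cube_measure. (\<Sum>i\<in>UNIV. G x $ i * H x $ i))"
  proof (rule integral_cong_AE)
    show "AE x in cube_measure. weak_gradient u x \<bullet> weak_gradient v x = (\<Sum>i\<in>UNIV. G x $ i * H x $ i)"
      using weak_gradient_unique_AE[OF wu G] weak_gradient_unique_AE[OF wv H]
      by eventually_elim (simp add: inner_vec_def)
  qed (auto simp: inner_vec_def intro!: borel_measurable_sum borel_measurable_times
        has_weak_gradientD(2)[OF G] has_weak_gradientD(2)[OF H] has_weak_gradientD(2)[OF wu] has_weak_gradientD(2)[OF wv])
  also have "\<dots> = (\<Sum>i\<in>UNIV. LINT x|cube_measure. G x $ i * H x $ i)"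
    by (intro Bochner_Integration.integral_sum integrable_mult_bounded[where C = C] AE_I2 bound
        has_weak_gradientD[OF G] has_weak_gradientD[OF H])
  finally show ?thesis .
qed

section \<open>Weak solutions of the Neumann problem\<close>

text \<open>
  The eigenvalue of \<open>-\<Delta>\<close> for the eigenfunction \<open>cos_basis k\<close>.
\<close>

definition neumann_eigenvalue :: "nat ^ 'd::finite \<Rightarrow> real" where
  "neumann_eigenvalue k = (\<Sum>i\<in>UNIV. (pi * real (k $ i))\<^sup>2)"

lemma component_le_neumann_eigenvalue: "(pi * real (k $ i))\<^sup>2 \<le> neumann_eigenvalue k"
  unfolding neumann_eigenvalue_def by (rule member_le_sum) auto

lemma neumann_eigenvalue_nonneg: "0 \<le> neumann_eigenvalue k"
  unfolding neumann_eigenvalue_def by (rule sum_nonneg) simp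

lemma frequency_le_neumann_eigenvalue: "pi * real (k $ i) \<le> neumann_eigenvalue k"
proof (cases "k $ i = 0")
  case True
  then show ?thesis by (simp add: neumann_eigenvalue_nonneg)
next
  case False
  then have "1 * 1 \<le> pi * real (k $ i)"
    using pi_ge_two by (intro mult_mono) auto
  then have "pi * real (k $ i) \<le> (pi * real (k $ i))\<^sup>2"
    by (intro self_le_power) auto
  then show ?thesis using component_le_neumann_eigenvalue by (rule order_trans)
qed

lemma neumann_eigenvalue_ge_1:
  assumes "k \<noteq> 0" shows "1 \<le> neumann_eigenvalue k"
proof -
  obtain i where "k $ i \<noteq> 0" using assms by (auto simp: vec_eq_iff)
  then have "1 * 1 \<le> pi * real (k $ i)"
    using pi_ge_two by (intro mult_mono) auto
  then show ?thesis using frequency_le_neumann_eigenvalue[of k i] by simp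
qed

lemma neumann_eigenvalue_0: "neumann_eigenvalue 0 = 0"
  by (simp add: neumann_eigenvalue_def)

text \<open>
  Dividing the coefficients of \<open>f\<close> by the eigenvalues preserves summability, even after one
  differentiation. At \<open>k = 0\<close> the quotient is \<open>0\<close> because division by zero yields zero.
\<close>

lemma abs_divide_eigenvalue_le:
  "\<bar>a / neumann_eigenvalue k\<bar> \<le> \<bar>a\<bar>"
  "\<bar>a / neumann_eigenvalue k * (pi * real (k $ i))\<bar> \<le> \<bar>a\<bar>"
proof -
  consider "k = 0" | "1 \<le> neumann_eigenvalue k" using neumann_eigenvalue_ge_1 by blast
  then have "\<bar>a / neumann_eigenvalue k\<bar> \<le> \<bar>a\<bar> \<and> \<bar>a / neumann_eigenvalue k * (pi * real (k $ i))\<bar> \<le> \<bar>a\<bar>"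
  proof cases
    case 2
    have "\<bar>a\<bar> * (pi * real (k $ i)) \<le> \<bar>a\<bar> * neumann_eigenvalue k" "\<bar>a\<bar> * 1 \<le> \<bar>a\<bar> * neumann_eigenvalue k"
      using frequency_le_neumann_eigenvalue[of k i] 2 by (auto intro!: mult_left_mono simp del: mult_1_right)
    then show ?thesis using 2 by (simp add: abs_mult pos_divide_le_eq)
  qed (simp add: neumann_eigenvalue_0)
  then show "\<bar>a / neumann_eigenvalue k\<bar> \<le> \<bar>a\<bar>"
    "\<bar>a / neumann_eigenvalue k * (pi * real (k $ i))\<bar> \<le> \<bar>a\<bar>" by auto
qed

definition cos_basis_gradient :: "nat ^ 'd::finite \<Rightarrow> real ^ 'd \<Rightarrow> real ^ 'd" where
  "cos_basis_gradient k x = (\<chi> i. - (pi * real (k $ i)) * sin_basis i k x)"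

lemma has_weak_gradient_cos_basis: "has_weak_gradient (cos_basis k) (cos_basis_gradient k)"
  unfolding has_weak_gradient_def
proof (intro allI conjI ballI)
  fix i
  have "\<bar>- (pi * real (k $ i)) * sin_basis i k x\<bar> \<le> pi * real (k $ i) * 1" for x
    unfolding abs_mult by (intro mult_mono) (auto simp: abs_sin_basis_le)
  then show "(\<lambda>x. cos_basis_gradient k x $ i) \<in> L2_cube"
    unfolding cos_basis_gradient_def vec_lambda_beta
    by (intro bounded_imp_L2_cube borel_measurable_times borel_measurable_const measurable_sin_basis)
qed (simp add: cos_basis_gradient_def cos_basis_by_parts mult.assoc)

lemma cos_basis_in_H1: "cos_basis k \<in> H1_cube"
  unfolding H1_cube_def using has_weak_gradient_cos_basis abs_cos_basis_le
  by (auto intro!: bounded_imp_L2_cube measurable_cos_basis)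

lemma cos_coeff_0_mean_zero: "mean_zero u \<Longrightarrow> cos_coeff u 0 = 0"
  by (simp add: cos_coeff_def mean_zero_def cos_basis_0)

text \<open>
  Test the weak formulation with \<open>cos_basis k\<close> and integrate by parts. For \<open>k = 0\<close>, where
  \<open>cos_basis k\<close> is not of mean zero, the left-hand side vanishes because \<open>u\<close> has mean zero, and the
  right-hand side is a division by zero, so that one formula serves all \<open>k\<close>.
\<close>

lemma weak_solution_cos_coeff:
  assumes "neumann_weak_solution f u"
  shows "cos_coeff u k = cos_coeff f k / neumann_eigenvalue k"
proof (cases "k = 0")
  case True
  then show ?thesis
    using assms cos_coeff_0_mean_zero[of u] by (simp add: neumann_weak_solution_def neumann_eigenvalue_0)
next
  case False
  obtain G where G: "has_weak_gradient u G" and u: "integrable cube_measure u"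
    using assms L2_cube_imp_integrable by (auto simp: neumann_weak_solution_def H1_cube_def)
  have "mean_zero (cos_basis k)"
    using cos_basis_orthogonal[OF False] by (simp add: mean_zero_def cos_basis_0)
  then have "(LINT x|cube_measure. f x * cos_basis k x) =
      (LINT x|cube_measure. weak_gradient u x \<bullet> weak_gradient (cos_basis k) x)"
    using assms cos_basis_in_H1[of k] unfolding neumann_weak_solution_def by metis
  also have "\<dots> = (\<Sum>i\<in>UNIV. LINT x|cube_measure. G x $ i * cos_basis_gradient k x $ i)"
  proof (rule integral_weak_gradients[OF G has_weak_gradient_cos_basis])
    fix x i
    have "\<bar>- (pi * real (k $ i)) * sin_basis i k x\<bar> \<le> neumann_eigenvalue k * 1"
      unfolding abs_mult using frequency_le_neumann_eigenvalue[of k i]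
      by (intro mult_mono) (auto simp: abs_sin_basis_le neumann_eigenvalue_nonneg)
    then show "\<bar>cos_basis_gradient k x $ i\<bar> \<le> neumann_eigenvalue k"
      by (simp add: cos_basis_gradient_def)
  qed
  also have "\<dots> = (\<Sum>i\<in>UNIV. (pi * real (k $ i))\<^sup>2 * (LINT x|cube_measure. u x * cos_basis k x))"
  proof (rule sum.cong[OF refl])
    fix i
    have "(LINT x|cube_measure. G x $ i * cos_basis_gradient k x $ i) =
        - (pi * real (k $ i)) * (LINT x|cube_measure. G x $ i * sin_basis i k x)"
      unfolding cos_basis_gradient_def vec_lambda_beta
      by (subst integral_mult_right_zero[symmetric]) (simp only: mult.left_commute)
    also have "(LINT x|cube_measure. G x $ i * sin_basis i k x) =
        - (pi * real (k $ i)) * (LINT x|cube_measure. u x * cos_basis k x)"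
      by (rule weak_derivative_against_sin_basis[OF u has_weak_gradientD(1)[OF G] has_weak_gradientD(3)[OF G]])
    finally show "(LINT x|cube_measure. G x $ i * cos_basis_gradient k x $ i) =
        (pi * real (k $ i))\<^sup>2 * (LINT x|cube_measure. u x * cos_basis k x)"
      by (simp add: power2_eq_square mult_ac)
  qed
  also have "\<dots> = neumann_eigenvalue k * (LINT x|cube_measure. u x * cos_basis k x)"
    by (simp add: neumann_eigenvalue_def sum_distrib_right)
  finally show ?thesis
    using neumann_eigenvalue_ge_1[OF False] by (simp add: cos_coeff_def)
qed

text \<open>
  The candidate is the cosine series with the coefficients dictated by
  \<open>weak_solution_cos_coeff\<close>; its termwise gradient converges uniformly. Summing the identities
  for the individual cosine products, the pairing with the gradient of an arbitrary \<open>v\<close> becomes the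
  pairing of \<open>v\<close> with the cosine series of \<open>f\<close>.
\<close>

lemma weak_solution_exists:
  fixes f :: "real ^ 'd::finite \<Rightarrow> real"
  assumes f: "integrable cube_measure f" "mean_zero f"
    and summ: "summable (\<lambda>n. \<bar>cos_coeff f (multi_index n)\<bar>)"
  shows "\<exists>u. neumann_weak_solution f u"
proof -
  define a where "a n = cos_coeff f (multi_index n)" for n
  define c where "c n = a n / neumann_eigenvalue (multi_index n :: nat ^ 'd)" for n
  define b where "b i n = - (c n * (pi * real (multi_index n $ i)))" for i :: 'd and n
  define u where "u x = (\<Sum>n. c n * cos_basis (multi_index n) x)" for x :: "real ^ 'd"
  define G where "G x = (\<chi> i. \<Sum>n. b i n * sin_basis i (multi_index n) x)" for x :: "real ^ 'd"
  have a: "summable (\<lambda>n. \<bar>a n\<bar>)" using summ by (simp add: a_def)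
  have c: "summable (\<lambda>n. \<bar>c n\<bar>)"
    by (rule summable_comparison_test'[OF a]) (simp only: c_def real_norm_def abs_idempotent abs_divide_eigenvalue_le)
  have b: "summable (\<lambda>n. \<bar>b i n\<bar>)" for i
    by (rule summable_comparison_test'[OF a])
       (simp only: b_def c_def real_norm_def abs_idempotent abs_minus_cancel abs_divide_eigenvalue_le)
  have u_sums: "(\<lambda>n. c n * (LINT x|cube_measure. w x * cos_basis (multi_index n) x)) sums (LINT x|cube_measure. w x * u x)"
    if "integrable cube_measure w" for w
    unfolding u_def by (rule weighted_series_sums[OF c that measurable_cos_basis abs_cos_basis_le])
  have f_sums: "(\<lambda>n. a n * (LINT x|cube_measure. w x * cos_basis (multi_index n) x))
      sums (LINT x|cube_measure. w x * (\<Sum>n. a n * cos_basis (multi_index n) x))"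
    if "integrable cube_measure w" for w :: "real ^ 'd \<Rightarrow> real"
    by (rule weighted_series_sums[OF a that measurable_cos_basis abs_cos_basis_le])
  have G_sums: "(\<lambda>n. b i n * (LINT x|cube_measure. w x * sin_basis i (multi_index n) x)) sums (LINT x|cube_measure. w x * G x $ i)"
    if "integrable cube_measure w" for w i
    unfolding G_def vec_lambda_beta by (rule weighted_series_sums[OF b that measurable_sin_basis abs_sin_basis_le])
  have u_L2: "u \<in> L2_cube"
  proof (rule bounded_imp_L2_cube)
    show "u \<in> borel_measurable cube_measure"
      unfolding u_def using measurable_cos_basis by measurable
    show "\<bar>u x\<bar> \<le> (\<Sum>n. \<bar>c n\<bar>)" for x
      unfolding u_def by (rule abs_series_le[OF c abs_cos_basis_le])
  qed
  have G_bound: "\<bar>G x $ i\<bar> \<le> (\<Sum>j\<in>UNIV. \<Sum>n. \<bar>b j n\<bar>)" for x i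
  proof -
    have "\<bar>G x $ i\<bar> \<le> (\<Sum>n. \<bar>b i n\<bar>)"
      unfolding G_def vec_lambda_beta by (rule abs_series_le[OF b abs_sin_basis_le])
    also have "\<dots> \<le> (\<Sum>j\<in>UNIV. \<Sum>n. \<bar>b j n\<bar>)"
      by (rule member_le_sum) (auto intro!: suminf_nonneg b)
    finally show ?thesis .
  qed
  have grad: "has_weak_gradient u G"
    unfolding has_weak_gradient_def
  proof (intro allI conjI ballI)
    fix i
    have "(\<lambda>x. G x $ i) \<in> borel_measurable cube_measure"
      unfolding G_def vec_lambda_beta using measurable_sin_basis by measurable
    then show "(\<lambda>x. G x $ i) \<in> L2_cube"
      using G_bound by (rule bounded_imp_L2_cube)
    fix \<phi> :: "real ^ 'd \<Rightarrow> real" assume \<phi>: "\<phi> \<in> test_functions"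
    have "(\<lambda>n. c n * (LINT x|cube_measure. partial_deriv i \<phi> x * cos_basis (multi_index n) x))
        sums (LINT x|cube_measure. partial_deriv i \<phi> x * u x)"
      by (intro u_sums integrable_cube_continuous test_functionD[OF \<phi>])
    moreover have "c n * (LINT x|cube_measure. partial_deriv i \<phi> x * cos_basis (multi_index n) x)
        = - (b i n * (LINT x|cube_measure. \<phi> x * sin_basis i (multi_index n) x))" for n
      using cos_basis_by_parts[OF \<phi>, of "multi_index n" i] by (simp add: b_def mult.commute)
    moreover have "(\<lambda>n. - (b i n * (LINT x|cube_measure. \<phi> x * sin_basis i (multi_index n) x)))
        sums - (LINT x|cube_measure. \<phi> x * G x $ i)"
      by (intro sums_minus G_sums integrable_cube_continuous test_functionD[OF \<phi>])
    ultimately have "(LINT x|cube_measure. partial_deriv i \<phi> x * u x) = - (LINT x|cube_measure. \<phi> x * G x $ i)"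
      by (simp only:) (rule sums_unique2)
    then show "(LINT x|cube_measure. u x * partial_deriv i \<phi> x) = - (LINT x|cube_measure. G x $ i * \<phi> x)"
      by (simp add: mult.commute)
  qed
  have "mean_zero u"
  proof -
    have zero: "c n * (LINT x|cube_measure. cos_basis 0 x * cos_basis (multi_index n) (x :: real ^ 'd)) = 0" for n
      using cos_basis_orthogonal[of 0 "multi_index n :: nat ^ 'd"]
      by (cases "multi_index n = (0 :: nat ^ 'd)") (simp_all add: c_def neumann_eigenvalue_0)
    have "(\<lambda>n. 0) sums (LINT x|cube_measure. cos_basis 0 x * u x)"
      using u_sums[OF integrable_cube_continuous[OF continuous_on_cos_basis], of 0] by (simp only: zero)
    then show ?thesis
      using sums_unique2[OF sums_zero] by (simp add: mean_zero_def cos_basis_0)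
  qed
  moreover have "(LINT x|cube_measure. weak_gradient u x \<bullet> weak_gradient v x) = (LINT x|cube_measure. f x * v x)"
    if vH1: "v \<in> H1_cube" for v
  proof -
    obtain H where H: "has_weak_gradient v H" and v: "integrable cube_measure v"
      using vH1 L2_cube_imp_integrable by (auto simp: H1_cube_def)
    have "(LINT x|cube_measure. weak_gradient u x \<bullet> weak_gradient v x) =
        (\<Sum>i\<in>UNIV. LINT x|cube_measure. H x $ i * G x $ i)"
      using integral_weak_gradients[OF H grad G_bound] by (simp add: inner_commute)
    moreover have "(\<lambda>n. \<Sum>i\<in>UNIV. b i n * (LINT x|cube_measure. H x $ i * sin_basis i (multi_index n) x))
        sums (\<Sum>i\<in>UNIV. LINT x|cube_measure. H x $ i * G x $ i)"
      by (intro sums_sum G_sums has_weak_gradientD[OF H])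
    moreover have "(\<Sum>i\<in>UNIV. b i n * (LINT x|cube_measure. H x $ i * sin_basis i (multi_index n) x))
        = a n * (LINT x|cube_measure. v x * cos_basis (multi_index n) x)" for n
    proof -
      define k where "k = (multi_index n :: nat ^ 'd)"
      define I where "I = (LINT x|cube_measure. v x * cos_basis k x)"
      have "(LINT x|cube_measure. H x $ i * sin_basis i k x) = - (pi * real (k $ i)) * I" for i
        unfolding I_def
        by (rule weak_derivative_against_sin_basis[OF v has_weak_gradientD(1)[OF H] has_weak_gradientD(3)[OF H]])
      then have "(\<Sum>i\<in>UNIV. b i n * (LINT x|cube_measure. H x $ i * sin_basis i k x)) =
          (\<Sum>i\<in>UNIV. c n * I * (pi * real (k $ i))\<^sup>2)"
        by (intro sum.cong) (simp_all add: b_def power2_eq_square mult_ac flip: k_def)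
      also have "\<dots> = c n * neumann_eigenvalue k * I"
        by (simp add: neumann_eigenvalue_def mult_ac flip: sum_distrib_left)
      \<comment> \<open>At \<open>k = 0\<close> this uses that \<open>f\<close> has mean zero.\<close>
      also have "c n * neumann_eigenvalue k = a n"
        using neumann_eigenvalue_ge_1[of k] cos_coeff_0_mean_zero[OF f(2)]
        by (cases "k = 0") (auto simp: c_def a_def simp flip: k_def)
      finally show ?thesis by (simp add: I_def k_def)
    qed
    ultimately have "(\<lambda>n. a n * (LINT x|cube_measure. v x * cos_basis (multi_index n) x))
        sums (LINT x|cube_measure. weak_gradient u x \<bullet> weak_gradient v x)"
      by simp
    then have "(LINT x|cube_measure. weak_gradient u x \<bullet> weak_gradient v x) =
        (LINT x|cube_measure. v x * (\<Sum>n. a n * cos_basis (multi_index n) x))"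
      using f_sums[OF v] by (rule sums_unique2)
    also have "\<dots> = (LINT x|cube_measure. f x * v x)"
    proof (rule integral_cong_AE)
      show "AE x in cube_measure. v x * (\<Sum>n. a n * cos_basis (multi_index n) x) = f x * v x"
        using cos_series_AE[OF f(1) summ] by eventually_elim (simp add: a_def mult.commute)
      have "v \<in> borel_measurable cube_measure" "f \<in> borel_measurable cube_measure"
        using v f by auto
      then show "(\<lambda>x. v x * (\<Sum>n. a n * cos_basis (multi_index n) x)) \<in> borel_measurable cube_measure"
        "(\<lambda>x. f x * v x) \<in> borel_measurable cube_measure"
        using measurable_cos_basis by measurable
    qed
    finally show ?thesis .
  qed
  moreover have "u \<in> H1_cube" using u_L2 grad by (auto simp: H1_cube_def)
  ultimately show ?thesis by (auto simp: neumann_weak_solution_def)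
qed

lemma weak_solution_unique_AE:
  assumes "neumann_weak_solution f u" "neumann_weak_solution f v"
  shows "AE x in cube_measure. u x = v x"
proof -
  have int: "integrable cube_measure u" "integrable cube_measure v"
    using assms by (auto simp: neumann_weak_solution_def H1_cube_def intro: L2_cube_imp_integrable)
  have "(LINT x|cube_measure. (u x - v x) * cos_basis k x) = 0" for k
  proof -
    have "cos_coeff u k = cos_coeff v k"
      using weak_solution_cos_coeff[OF assms(1)] weak_solution_cos_coeff[OF assms(2)] by simp
    then have "(LINT x|cube_measure. u x * cos_basis k x) = (LINT x|cube_measure. v x * cos_basis k x)"
      using integral_cos_basis_square_pos[of k] by (simp add: cos_coeff_def)
    moreover have "integrable cube_measure (\<lambda>x. u x * cos_basis k x)" "integrable cube_measure (\<lambda>x. v x * cos_basis k x)"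
      using int by (auto intro!: integrable_mult_bounded[OF _ measurable_cos_basis, where C = 1] simp: abs_cos_basis_le)
    ultimately show ?thesis by (simp add: left_diff_distrib)
  qed
  then have "AE x in cube_measure. u x - v x = 0"
    using int by (intro cos_basis_complete) auto
  then show ?thesis by simp
qed

section \<open>Barron norms\<close>

lemma barron_weight_ge_1: "1 \<le> barron_weight s k"
  by (simp add: barron_weight_def)

lemma barron_space_imp_summable:
  fixes f :: "real ^ 'd::finite \<Rightarrow> real"
  assumes "f \<in> barron_space s"
  shows "summable (\<lambda>n. \<bar>cos_coeff f (multi_index n)\<bar>)"
proof (rule summableI_nonneg_bounded)
  fix N
  have inj: "inj_on (multi_index :: nat \<Rightarrow> nat ^ 'd) {..<N}"
    using bij_is_inj[OF bij_multi_index] by (rule inj_on_subset) simp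
  have "ennreal (\<Sum>n<N. \<bar>cos_coeff f (multi_index n)\<bar>) = (\<Sum>n<N. ennreal \<bar>cos_coeff f (multi_index n)\<bar>)"
    by simp
  also have "\<dots> = (\<Sum>k\<in>multi_index ` {..<N}. ennreal \<bar>cos_coeff f k\<bar>)"
    by (simp add: sum.reindex[OF inj])
  also have "\<dots> \<le> (\<Sum>k\<in>multi_index ` {..<N}. ennreal (barron_weight s k * \<bar>cos_coeff f k\<bar>))"
    using mult_right_mono[OF barron_weight_ge_1 abs_ge_zero] by (intro sum_mono ennreal_leI) simp
  also have "\<dots> \<le> barron_norm s f"
    unfolding barron_norm_def by (subst nonneg_infsum_complete) (auto intro!: SUP_upper)
  finally have "enn2real (ennreal (\<Sum>n<N. \<bar>cos_coeff f (multi_index n)\<bar>)) \<le> enn2real (barron_norm s f)"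
    using assms by (intro enn2real_mono) (auto simp: barron_space_def)
  then show "(\<Sum>n<N. \<bar>cos_coeff f (multi_index n)\<bar>) \<le> enn2real (barron_norm s f)"
    by (simp add: sum_nonneg)
qed simp

lemma l1_norm_ge_1:
  assumes "k \<noteq> 0" shows "1 \<le> l1_norm k"
proof -
  obtain i where "k $ i \<noteq> 0" using assms by (auto simp: vec_eq_iff)
  then have "1 \<le> real (k $ i)" by simp
  also have "\<dots> \<le> l1_norm k" unfolding l1_norm_def by (rule member_le_sum) auto
  finally show ?thesis .
qed

text \<open>
  Cauchy--Schwarz between the \<open>\<ell>\<^sup>1\<close>- and the \<open>\<ell>\<^sup>2\<close>-norm; the only source of the factor \<open>d\<close>.
\<close>

lemma l1_norm_le_neumann_eigenvalue:
  fixes k :: "nat ^ 'd::finite"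
  shows "(pi * l1_norm k)\<^sup>2 \<le> real CARD('d) * neumann_eigenvalue k"
proof -
  have "(\<Sum>i\<in>UNIV. (pi * real (k $ i)) * 1)\<^sup>2 \<le> (\<Sum>i\<in>UNIV. (pi * real (k $ i))\<^sup>2) * (\<Sum>i\<in>(UNIV :: 'd set). 1\<^sup>2)"
    by (rule Cauchy_Schwarz_ineq_sum)
  then show ?thesis
    by (simp add: l1_norm_def neumann_eigenvalue_def sum_distrib_left mult.commute)
qed

text \<open>
  Write \<open>L\<close> for the \<open>\<ell>\<^sup>1\<close>-norm of \<open>k\<close> and \<open>p = (\<pi> L)\<^sup>s\<close>. For \<open>k \<noteq> 0\<close> one has \<open>\<pi> L \<ge> 1\<close>, so the weight
  \<open>1 + (\<pi> L)\<^sup>2 p\<close> is at most \<open>(\<pi> L)\<^sup>2 (1 + p)\<close>, and \<open>(\<pi> L)\<^sup>2\<close> is at most \<open>d\<close> times the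
  eigenvalue.
\<close>

lemma barron_weight_shift_le:
  fixes k :: "nat ^ 'd::finite"
  assumes "s \<ge> 0"
  shows "barron_weight (s + 2) k * \<bar>a / neumann_eigenvalue k\<bar> \<le> real CARD('d) * (barron_weight s k * \<bar>a\<bar>)"
proof (cases "k = 0")
  case True
  have "0 \<le> barron_weight s k" using barron_weight_ge_1[of s k] by linarith
  then show ?thesis using True by (simp add: neumann_eigenvalue_0)
next
  case False
  define L where "L = l1_norm k"
  define e where "e = neumann_eigenvalue k"
  define p where "p = pi powr s * L powr s"
  have L: "1 \<le> L" and e: "1 \<le> e" using l1_norm_ge_1 neumann_eigenvalue_ge_1 False by (auto simp: L_def e_def)
  have p: "0 \<le> p" by (simp add: p_def)
  have "barron_weight s k = 1 + p"
    using L by (simp add: barron_weight_def p_def flip: L_def)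
  have "barron_weight (s + 2) k = 1 + (pi * L)\<^sup>2 * p"
    using L assms by (simp add: barron_weight_def p_def powr_add power_mult_distrib flip: L_def)
  also have "\<dots> \<le> (pi * L)\<^sup>2 * (1 + p)"
  proof -
    have "1 * 1 \<le> pi * L" using pi_ge_two L by (intro mult_mono) auto
    then have "1 \<le> (pi * L)\<^sup>2" by (simp add: one_le_power)
    then show ?thesis by (simp add: distrib_left)
  qed
  also have "\<dots> \<le> (real CARD('d) * e) * (1 + p)"
    using l1_norm_le_neumann_eigenvalue[of k] p by (intro mult_right_mono) (auto simp: L_def e_def)
  finally have "barron_weight (s + 2) k \<le> real CARD('d) * e * barron_weight s k"
    by (simp add: \<open>barron_weight s k = 1 + p\<close>)
  then have "barron_weight (s + 2) k * (\<bar>a\<bar> / e) \<le> real CARD('d) * e * barron_weight s k * (\<bar>a\<bar> / e)"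
    using e by (intro mult_right_mono) auto
  then show ?thesis using e by (simp add: abs_divide mult_ac flip: e_def)
qed

lemma barron_norm_weak_solution_le:
  fixes f u :: "real ^ 'd::finite \<Rightarrow> real"
  assumes "s \<ge> 0" "neumann_weak_solution f u"
  shows "barron_norm (s + 2) u \<le> of_nat CARD('d) * barron_norm s f"
proof -
  have term_le: "ennreal (barron_weight (s + 2) k * \<bar>cos_coeff u k\<bar>)
      \<le> of_nat CARD('d) * ennreal (barron_weight s k * \<bar>cos_coeff f k\<bar>)" for k
  proof -
    have "0 \<le> barron_weight s k * \<bar>cos_coeff f k\<bar>"
      using barron_weight_ge_1[of s k] by simp
    then show ?thesis
      unfolding weak_solution_cos_coeff[OF assms(2)]
      using ennreal_leI[OF barron_weight_shift_le[OF assms(1), of k "cos_coeff f k"]]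
      by (simp only: ennreal_mult[OF of_nat_0_le_iff] ennreal_of_nat_eq_real_of_nat)
  qed
  have "(\<Sum>k\<in>F. ennreal (barron_weight (s + 2) k * \<bar>cos_coeff u k\<bar>)) \<le> of_nat CARD('d) * barron_norm s f"
    if "finite F" for F
  proof -
    have "(\<Sum>k\<in>F. ennreal (barron_weight (s + 2) k * \<bar>cos_coeff u k\<bar>))
        \<le> of_nat CARD('d) * (\<Sum>k\<in>F. ennreal (barron_weight s k * \<bar>cos_coeff f k\<bar>))"
      unfolding sum_distrib_left by (intro sum_mono term_le)
    also have "\<dots> \<le> of_nat CARD('d) * barron_norm s f"
      unfolding barron_norm_def using that
      by (intro mult_left_mono) (auto simp: nonneg_infsum_complete intro!: SUP_upper)
    finally show ?thesis .
  qed
  then show ?thesis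
    unfolding barron_norm_def[of "s + 2"] by (subst nonneg_infsum_complete) (auto intro!: SUP_least)
qed

theorem theorem2p5:
  fixes s :: real and f :: "real ^ 'd \<Rightarrow> real"
  assumes "s \<ge> 0"
    and "f \<in> barron_space s"
    and "mean_zero f"
  shows "(\<exists>u. neumann_weak_solution f u)
    \<and> (\<forall>u v. neumann_weak_solution f u \<and> neumann_weak_solution f v \<longrightarrow>
          (AE x in cube_measure. u x = v x))
    \<and> (\<forall>u. neumann_weak_solution f u \<longrightarrow>
          u \<in> barron_space (s + 2)
        \<and> barron_norm (s + 2) u \<le> of_nat CARD('d) * barron_norm s f
        \<and> (s = 0 \<longrightarrow> barron_norm 2 u \<le> of_nat CARD('d) * barron_norm 0 f))"
proof (intro conjI allI impI)
  show "\<exists>u. neumann_weak_solution f u"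
    using assms by (intro weak_solution_exists barron_space_imp_summable) (auto simp: barron_space_def)
  show "AE x in cube_measure. u x = v x" if "neumann_weak_solution f u \<and> neumann_weak_solution f v" for u v
    using that weak_solution_unique_AE by blast
  fix u assume u: "neumann_weak_solution f u"
  show le: "barron_norm (s + 2) u \<le> of_nat CARD('d) * barron_norm s f"
    by (rule barron_norm_weak_solution_le[OF assms(1) u])
  then show "barron_norm 2 u \<le> of_nat CARD('d) * barron_norm 0 f" if "s = 0"
    using that by simp
  have "of_nat CARD('d) * barron_norm s f < \<infinity>"
    using assms(2) by (simp add: barron_space_def ennreal_mult_less_top of_nat_less_top)
  with le have "barron_norm (s + 2) u < \<infinity>" by (rule le_less_trans)
  moreover have "integrable cube_measure u"
    using u by (auto simp: neumann_weak_solution_def H1_cube_def intro: L2_cube_imp_integrable)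
  ultimately show "u \<in> barron_space (s + 2)" by (simp add: barron_space_def)
qed

end
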